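(* Let $\mathbf C$ be a cubical $\omega$-category, $A\in\mathbf C_n$ and $1\le j\le n$. Then $A$ is $R_j$-invertible if and only if $A$ is invertible and has an $R_j$-invertible shell. Moreover, if $A$ is thin (and $R_j$-invertible), then so is its $R_j$-inverse.
   Context: Index notation: for positive integers $i,j$, $j^i=j$ if $j<i$ and $j^i=j+1$ if $j\ge i$; for $j\neq i$, $j_i=j$ if $j<i$ and $j_i=j-1$ if $j>i$. Cubical $\omega$-categories (always with connections): a cubical $\omega$-category $\mathbf C$ consists of sets $\mathbf C_n$ ($n\ge0$), maps $\partial_i^\alpha:\mathbf C_n\to\mathbf C_{n-1}$ and $\Gamma_i^\alpha:\mathbf C_n\to\mathbf C_{n+1}$ ($n\ge1$, $1\le i\le n$, $\alpha=\pm$), maps $\epsilon_i:\mathbf C_n\to\mathbf C_{n+1}$ ($n\ge0$, $1\le i\le n+1$), and partial operations $\star_i$ on $\mathbf C_n$ ($1\le i\le n$), with $A\star_iB$ defined exactly when $\partial_i^+A=\partial_i^-B$, subject to (for all indices and cells for which both sides make sense): - $\partial_{j-1}^\alpha\partial_i^\beta=\partial_i^\beta\partial_j^\alpha$ for $i<j$; - $\partial_i^\alpha\epsilon_j=\epsilon_{j_i}\partial_{i_j}^\alpha$ for $i\ne j$, and $\partial_i^\alpha\epsilon_i=\mathrm{id}$; - $\partial_i^\alpha\Gamma_j^\beta=\Gamma_{j_i}^\beta\partial_{i_j}^\alpha$ for $i\ne j,j+1$; for $i\in\{j,j+1\}$, $\partial_i^\alpha\Gamma_j^\alpha=\mathrm{id}$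 and $\partial_i^\alpha\Gamma_j^{-\alpha}=\epsilon_j\partial_j^\alpha$; - $\epsilon_i\epsilon_j=\epsilon_{j+1}\epsilon_i$ for $i\le j$; $\Gamma_i^\alpha\Gamma_j^\beta=\Gamma_{j+1}^\beta\Gamma_i^\alpha$ for $i<j$; $\Gamma_{i+1}^\alpha\Gamma_i^\alpha=\Gamma_i^\alpha\Gamma_i^\alpha$; $\Gamma_i^\alpha\epsilon_j=\epsilon_{j^i}\Gamma_{i_j}^\alpha$ for $i\ne j$; $\Gamma_i^\alpha\epsilon_i=\epsilon_i\epsilon_i$; - $\partial_i^\alpha(A\star_jB)=\partial_i^\alpha A\star_{j_i}\partial_i^\alpha B$ for $i\neq j$; $\partial_i^-(A\star_iB)=\partial_i^-A$; $\partial_i^+(A\star_iB)=\partial_i^+B$; - $\star_i$ is associative; $A\star_i\epsilon_i\partial_i^+A=\epsilon_i\partial_i^-A\star_iA=A$; $(A\star_iB)\star_j(C\star_iD)=(A\star_jC)\star_i(B\star_jD)$ for $i\neq j$; - $\epsilon_i(A\star_jB)=\epsilon_iA\star_{j^i}\epsilon_iB$; $\Gamma_i^\alpha(A\star_jB)=\Gamma_i^\alpha A\star_{j^i}\Gamma_i^\alpha B$ for $i\ne j$; $\Gamma_i^-(A\star_iB)=(\Gamma_i^-A\star_i\epsilon_{i+1}B)\star_{i+1}(\epsilon_iB\star_i\Gamma_i^-B)$; $\Gamma_i^+(A\star_iB)=(\Gamma_i^+A\star_i\epsilon_iA)\star_{i+1}(\epsilon_{i+1}A\star_i\Gamma_i^+B)$;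 - $\Gamma_i^+A\star_i\Gamma_i^-A=\epsilon_{i+1}A$; $\Gamma_i^+A\star_{i+1}\Gamma_i^-A=\epsilon_iA$. A cubical $n$-category is the same structure restricted to dimensions $\le n$; $\mathrm{tr}_n\mathbf C$ denotes the truncation of $\mathbf C$ to dimensions $\le n$. $R_k$-invertibility. $A\in\mathbf C_n$ is $R_k$-invertible ($1\le k\le n$) if there is $B\in\mathbf C_n$ with $A\star_kB=\epsilon_k\partial_k^-A$ and $B\star_kA=\epsilon_k\partial_k^+A$; $B=R_kA$ is then the $R_k$-inverse of $A$. Plain invertibility and thinness. For $1\le i\le n-1$ put $\psi_iA=\Gamma_i^+\partial_{i+1}^-A\star_{i+1}A\star_{i+1}\Gamma_i^-\partial_{i+1}^+A$. A cell $A\in\mathbf C_n$ ($n\ge1$) is invertible if $\psi_1\cdots\psi_{n-1}A$ is $R_1$-invertible, and thin if $\psi_1\cdots\psi_{n-1}A$ lies in the image of $\epsilon_1$. Shells. For a cubical $n$-category $\mathbf C$, $\Box\mathbf C$ is the cubical $(n+1)$-category equal to $\mathbf C$ in dimensions $\le n$, whose $(n+1)$-cells are the families $A=(A_i^\alpha)_{1\le i\le n+1,\alpha=\pm}$ of $n$-cells with $\partial_{i_j}^\alpha A_j^\beta=\partial_{j_i}^\beta A_i^\alpha$ for $i\ne j$, with $\partial_i^\alpha A=A_i^\alpha$; for $A\in\mathbf C_n$, $\epsilon_iA$ and $\Gamma_i^\alpha A$ in dimension $n+1$ are the families of faces prescribed by the axioms above; $(A\star_iB)_i^-=A_i^-$,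 $(A\star_iB)_i^+=B_i^+$, $(A\star_iB)_j^\alpha=A_j^\alpha\star_{i_j}B_j^\alpha$ for $j\neq i$. For a cubical $\omega$-category $\mathbf C$ and $A\in\mathbf C_n$ ($n\ge1$), the shell of $A$ is $\boldsymbol\partial A=(\partial_i^\alpha A)$, an $n$-cell of $\Box\,\mathrm{tr}_{n-1}\mathbf C$; $A$ has an $R_k$-invertible shell if $\boldsymbol\partial A$ is $R_k$-invertible in $\Box\,\mathrm{tr}_{n-1}\mathbf C$. *)

theory Defs
  imports Main
begin

datatype sign = Minus | Plus

fun opposite :: "sign \<Rightarrow> sign" where
  "opposite Minus = Plus"
| "opposite Plus = Minus"

(* raise j i is the index j^i, and lower j i is the index j_i
   (the latter is only meaningful for j different from i). *)
definition raise :: "nat \<Rightarrow> nat \<Rightarrow> nat" where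
  "raise j i = (if j < i then j else j + 1)"

definition lower :: "nat \<Rightarrow> nat \<Rightarrow> nat" where
  "lower j i = (if j < i then j else j - 1)"

(* The sets of n-cells need not be disjoint for different n, so every operation takes as its
   first natural number argument the dimension n of the cells it is applied to:
   face C n i a : C_n -> C_(n-1),     degen C n i : C_n -> C_(n+1)   (the map epsilon_i),
   conn C n i a : C_n -> C_(n+1)  (the map Gamma_i^a),
   pcomp C n i  : partial composition of n-cells in direction i.
   All operations are total HOL functions, with irrelevant values outside these domains. *)
record 'a cubical =
  cells :: "nat \<Rightarrow> 'a set"
  face :: "nat \<Rightarrow> nat \<Rightarrow> sign \<Rightarrow> 'a \<Rightarrow> 'a"
  degen :: "nat \<Rightarrow> nat \<Rightarrow> 'a \<Rightarrow> 'a"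
  conn :: "nat \<Rightarrow> nat \<Rightarrow> sign \<Rightarrow> 'a \<Rightarrow> 'a"
  pcomp :: "nat \<Rightarrow> nat \<Rightarrow> 'a \<Rightarrow> 'a \<Rightarrow> 'a"

definition composable :: "'a cubical \<Rightarrow> nat \<Rightarrow> nat \<Rightarrow> 'a \<Rightarrow> 'a \<Rightarrow> bool" where
  "composable C n i A B \<longleftrightarrow>
     A \<in> cells C n \<and> B \<in> cells C n \<and> face C n i Plus A = face C n i Minus B"

locale cubical_omega_category =
  fixes C :: "'a cubical"
  assumes face_closed:
      "\<lbrakk>A \<in> cells C n; 1 \<le> i; i \<le> n\<rbrakk> \<Longrightarrow> face C n i \<alpha> A \<in> cells C (n - 1)"
    and degen_closed:
      "\<lbrakk>A \<in> cells C n; 1 \<le> i; i \<le> n + 1\<rbrakk> \<Longrightarrow> degen C n i A \<in> cells C (n + 1)"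
    and conn_closed:
      "\<lbrakk>A \<in> cells C n; 1 \<le> i; i \<le> n\<rbrakk> \<Longrightarrow> conn C n i \<alpha> A \<in> cells C (n + 1)"
    and pcomp_closed:
      "\<lbrakk>composable C n i A B; 1 \<le> i; i \<le> n\<rbrakk> \<Longrightarrow> pcomp C n i A B \<in> cells C n"

    and face_face:
      "\<lbrakk>A \<in> cells C n; 1 \<le> i; i < j; j \<le> n\<rbrakk> \<Longrightarrow>
        face C (n - 1) (j - 1) \<alpha> (face C n i \<beta> A) = face C (n - 1) i \<beta> (face C n j \<alpha> A)"

    and face_degen_neq:
      "\<lbrakk>A \<in> cells C n; 1 \<le> i; i \<le> n + 1; 1 \<le> j; j \<le> n + 1; i \<noteq> j\<rbrakk> \<Longrightarrow>
        face C (n + 1) i \<alpha> (degen C n j A)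
          = degen C (n - 1) (lower j i) (face C n (lower i j) \<alpha> A)"
    and face_degen_eq:
      "\<lbrakk>A \<in> cells C n; 1 \<le> i; i \<le> n + 1\<rbrakk> \<Longrightarrow> face C (n + 1) i \<alpha> (degen C n i A) = A"

    and face_conn_neq:
      "\<lbrakk>A \<in> cells C n; 1 \<le> i; i \<le> n + 1; 1 \<le> j; j \<le> n; i \<noteq> j; i \<noteq> j + 1\<rbrakk> \<Longrightarrow>
        face C (n + 1) i \<alpha> (conn C n j \<beta> A)
          = conn C (n - 1) (lower j i) \<beta> (face C n (lower i j) \<alpha> A)"
    and face_conn_same:
      "\<lbrakk>A \<in> cells C n; 1 \<le> j; j \<le> n; i = j \<or> i = j + 1\<rbrakk> \<Longrightarrow>
        face C (n + 1) i \<alpha> (conn C n j \<alpha> A) = A"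
    and face_conn_opposite:
      "\<lbrakk>A \<in> cells C n; 1 \<le> j; j \<le> n; i = j \<or> i = j + 1\<rbrakk> \<Longrightarrow>
        face C (n + 1) i \<alpha> (conn C n j (opposite \<alpha>) A) = degen C (n - 1) j (face C n j \<alpha> A)"

    and degen_degen:
      "\<lbrakk>A \<in> cells C n; 1 \<le> i; i \<le> j; j \<le> n + 1\<rbrakk> \<Longrightarrow>
        degen C (n + 1) i (degen C n j A) = degen C (n + 1) (j + 1) (degen C n i A)"
    and conn_conn_less:
      "\<lbrakk>A \<in> cells C n; 1 \<le> i; i < j; j \<le> n\<rbrakk> \<Longrightarrow>
        conn C (n + 1) i \<alpha> (conn C n j \<beta> A) = conn C (n + 1) (j + 1) \<beta> (conn C n i \<alpha> A)"
    and conn_conn_Suc: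
      "\<lbrakk>A \<in> cells C n; 1 \<le> i; i \<le> n\<rbrakk> \<Longrightarrow>
        conn C (n + 1) (i + 1) \<alpha> (conn C n i \<alpha> A) = conn C (n + 1) i \<alpha> (conn C n i \<alpha> A)"
    and conn_degen_neq:
      "\<lbrakk>A \<in> cells C n; 1 \<le> i; i \<le> n + 1; 1 \<le> j; j \<le> n + 1; i \<noteq> j\<rbrakk> \<Longrightarrow>
        conn C (n + 1) i \<alpha> (degen C n j A)
          = degen C (n + 1) (raise j i) (conn C n (lower i j) \<alpha> A)"
    and conn_degen_eq:
      "\<lbrakk>A \<in> cells C n; 1 \<le> i; i \<le> n + 1\<rbrakk> \<Longrightarrow>
        conn C (n + 1) i \<alpha> (degen C n i A) = degen C (n + 1) i (degen C n i A)"

    and face_pcomp_neq: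
      "\<lbrakk>composable C n j A B; 1 \<le> i; i \<le> n; 1 \<le> j; j \<le> n; i \<noteq> j\<rbrakk> \<Longrightarrow>
        face C n i \<alpha> (pcomp C n j A B)
          = pcomp C (n - 1) (lower j i) (face C n i \<alpha> A) (face C n i \<alpha> B)"
    and face_pcomp_Minus:
      "\<lbrakk>composable C n i A B; 1 \<le> i; i \<le> n\<rbrakk> \<Longrightarrow>
        face C n i Minus (pcomp C n i A B) = face C n i Minus A"
    and face_pcomp_Plus:
      "\<lbrakk>composable C n i A B; 1 \<le> i; i \<le> n\<rbrakk> \<Longrightarrow>
        face C n i Plus (pcomp C n i A B) = face C n i Plus B"

    and pcomp_assoc:
      "\<lbrakk>composable C n i A B; composable C n i B D; 1 \<le> i; i \<le> n\<rbrakk> \<Longrightarrow>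
        pcomp C n i (pcomp C n i A B) D = pcomp C n i A (pcomp C n i B D)"
    and pcomp_unit_right:
      "\<lbrakk>A \<in> cells C n; 1 \<le> i; i \<le> n\<rbrakk> \<Longrightarrow>
        pcomp C n i A (degen C (n - 1) i (face C n i Plus A)) = A"
    and pcomp_unit_left:
      "\<lbrakk>A \<in> cells C n; 1 \<le> i; i \<le> n\<rbrakk> \<Longrightarrow>
        pcomp C n i (degen C (n - 1) i (face C n i Minus A)) A = A"
    and pcomp_interchange:
      "\<lbrakk>composable C n i A B; composable C n i D E; composable C n j A D; composable C n j B E;
        1 \<le> i; i \<le> n; 1 \<le> j; j \<le> n; i \<noteq> j\<rbrakk> \<Longrightarrow>
        pcomp C n j (pcomp C n i A B) (pcomp C n i D E)
          = pcomp C n i (pcomp C n j A D) (pcomp C n j B E)"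

    and degen_pcomp:
      "\<lbrakk>composable C n j A B; 1 \<le> i; i \<le> n + 1; 1 \<le> j; j \<le> n\<rbrakk> \<Longrightarrow>
        degen C n i (pcomp C n j A B)
          = pcomp C (n + 1) (raise j i) (degen C n i A) (degen C n i B)"
    and conn_pcomp_neq:
      "\<lbrakk>composable C n j A B; 1 \<le> i; i \<le> n; 1 \<le> j; j \<le> n; i \<noteq> j\<rbrakk> \<Longrightarrow>
        conn C n i \<alpha> (pcomp C n j A B)
          = pcomp C (n + 1) (raise j i) (conn C n i \<alpha> A) (conn C n i \<alpha> B)"
    and conn_pcomp_Minus:
      "\<lbrakk>composable C n i A B; 1 \<le> i; i \<le> n\<rbrakk> \<Longrightarrow>
        conn C n i Minus (pcomp C n i A B)
          = pcomp C (n + 1) (i + 1)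
              (pcomp C (n + 1) i (conn C n i Minus A) (degen C n (i + 1) B))
              (pcomp C (n + 1) i (degen C n i B) (conn C n i Minus B))"
    and conn_pcomp_Plus:
      "\<lbrakk>composable C n i A B; 1 \<le> i; i \<le> n\<rbrakk> \<Longrightarrow>
        conn C n i Plus (pcomp C n i A B)
          = pcomp C (n + 1) (i + 1)
              (pcomp C (n + 1) i (conn C n i Plus A) (degen C n i A))
              (pcomp C (n + 1) i (degen C n (i + 1) A) (conn C n i Plus B))"

    and conn_transport:
      "\<lbrakk>A \<in> cells C n; 1 \<le> i; i \<le> n\<rbrakk> \<Longrightarrow>
        pcomp C (n + 1) i (conn C n i Plus A) (conn C n i Minus A) = degen C n (i + 1) A"
    and conn_transport_Suc:
      "\<lbrakk>A \<in> cells C n; 1 \<le> i; i \<le> n\<rbrakk> \<Longrightarrow>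
        pcomp C (n + 1) (i + 1) (conn C n i Plus A) (conn C n i Minus A) = degen C n i A"

definition is_R_inverse :: "'a cubical \<Rightarrow> nat \<Rightarrow> nat \<Rightarrow> 'a \<Rightarrow> 'a \<Rightarrow> bool" where
  "is_R_inverse C n k A B \<longleftrightarrow>
     composable C n k A B \<and> pcomp C n k A B = degen C (n - 1) k (face C n k Minus A) \<and>
     composable C n k B A \<and> pcomp C n k B A = degen C (n - 1) k (face C n k Plus A)"

definition R_invertible :: "'a cubical \<Rightarrow> nat \<Rightarrow> nat \<Rightarrow> 'a \<Rightarrow> bool" where
  "R_invertible C n k A \<longleftrightarrow> (\<exists>B. is_R_inverse C n k A B)"

definition psi :: "'a cubical \<Rightarrow> nat \<Rightarrow> nat \<Rightarrow> 'a \<Rightarrow> 'a" where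
  "psi C n i A =
     pcomp C n (i + 1)
       (pcomp C n (i + 1) (conn C (n - 1) i Plus (face C n (i + 1) Minus A)) A)
       (conn C (n - 1) i Minus (face C n (i + 1) Plus A))"

(* psi_1 (psi_2 (... (psi_(n-1) A))): the operator with the largest index acts first. *)
definition Psi :: "'a cubical \<Rightarrow> nat \<Rightarrow> 'a \<Rightarrow> 'a" where
  "Psi C n A = foldr (psi C n) [1..<n] A"

definition invertible :: "'a cubical \<Rightarrow> nat \<Rightarrow> 'a \<Rightarrow> bool" where
  "invertible C n A \<longleftrightarrow> A \<in> cells C n \<and> R_invertible C n 1 (Psi C n A)"

definition thin :: "'a cubical \<Rightarrow> nat \<Rightarrow> 'a \<Rightarrow> bool" where
  "thin C n A \<longleftrightarrow> A \<in> cells C n \<and> Psi C n A \<in> degen C (n - 1) 1 ` cells C (n - 1)"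

definition trunc :: "nat \<Rightarrow> 'a cubical \<Rightarrow> 'a cubical" where
  "trunc n C = C\<lparr>cells := (\<lambda>m. if m \<le> n then cells C m else {})\<rparr>"

datatype 'a box_cell = Old 'a | Family "nat \<Rightarrow> sign \<Rightarrow> 'a"

primrec old_cell :: "'a box_cell \<Rightarrow> 'a" where
  "old_cell (Old A) = A"
| "old_cell (Family F) = undefined"

primrec family :: "'a box_cell \<Rightarrow> nat \<Rightarrow> sign \<Rightarrow> 'a" where
  "family (Old A) = undefined"
| "family (Family F) = F"

(* Families of faces of an N-cell are indexed by i = 1, ..., N; their value elsewhere is fixed to
   be undefined, so that equality of families is equality of all their members. *)
definition mk_family :: "nat \<Rightarrow> (nat \<Rightarrow> sign \<Rightarrow> 'a) \<Rightarrow> 'a box_cell" where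
  "mk_family N F = Family (\<lambda>i \<alpha>. if 1 \<le> i \<and> i \<le> N then F i \<alpha> else undefined)"

definition matching_families :: "nat \<Rightarrow> 'a cubical \<Rightarrow> 'a box_cell set" where
  "matching_families n C =
     {mk_family (n + 1) F | F.
        (\<forall>i\<in>{1..n + 1}. \<forall>\<alpha>. F i \<alpha> \<in> cells C n) \<and>
        (\<forall>i\<in>{1..n + 1}. \<forall>j\<in>{1..n + 1}. i \<noteq> j \<longrightarrow> (\<forall>\<alpha> \<beta>.
           face C n (lower i j) \<alpha> (F j \<beta>) = face C n (lower j i) \<beta> (F i \<alpha>)))}"

(* For a cubical n-category C (a cubical structure used in dimensions at most n only),
   box n C is the cubical (n+1)-category of shells. *)
definition box :: "nat \<Rightarrow> 'a cubical \<Rightarrow> 'a box_cell cubical" where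
  "box n C = \<lparr>
     cells = (\<lambda>m. if m \<le> n then Old ` cells C m
                  else if m = n + 1 then matching_families n C
                  else {}),
     face = (\<lambda>m i \<alpha> A. if m \<le> n then Old (face C m i \<alpha> (old_cell A))
                       else Old (family A i \<alpha>)),
     degen = (\<lambda>m i A. if m < n then Old (degen C m i (old_cell A))
                      else mk_family (n + 1) (\<lambda>j \<alpha>.
                        if j = i then old_cell A
                        else degen C (n - 1) (lower i j) (face C n (lower j i) \<alpha> (old_cell A)))),
     conn = (\<lambda>m i \<beta> A. if m < n then Old (conn C m i \<beta> (old_cell A))
                       else mk_family (n + 1) (\<lambda>j \<alpha>.
                         if j = i \<or> j = i + 1
                         then (if \<alpha> = \<beta> then old_cell A
                               else degen C (n - 1) i (face C n i \<alpha> (old_cell A)))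
                         else conn C (n - 1) (lower i j) \<beta>
                                (face C n (lower j i) \<alpha> (old_cell A)))),
     pcomp = (\<lambda>m i A B. if m \<le> n then Old (pcomp C m i (old_cell A) (old_cell B))
                        else mk_family (n + 1) (\<lambda>j \<alpha>.
                          if j = i
                          then (case \<alpha> of Minus \<Rightarrow> family A i Minus | Plus \<Rightarrow> family B i Plus)
                          else pcomp C n (lower i j) (family A j \<alpha>) (family B j \<alpha>)))\<rparr>"

definition shell :: "'a cubical \<Rightarrow> nat \<Rightarrow> 'a \<Rightarrow> 'a box_cell" where
  "shell C n A = mk_family n (\<lambda>i \<alpha>. face C n i \<alpha> A)"

definition has_R_invertible_shell :: "'a cubical \<Rightarrow> nat \<Rightarrow> nat \<Rightarrow> 'a \<Rightarrow> bool" where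
  "has_R_invertible_shell C n k A \<longleftrightarrow>
     R_invertible (box (n - 1) (trunc (n - 1) C)) n k (shell C n A)"

end

theory Submission
  imports Defs
begin

text \<open>
  The directions \<open>i\<close> (drawn vertically) and \<open>i + 1\<close> (horizontally) make the \<open>n\<close>-cells of a cubical
  category into the squares of a double category with connections. There \<open>\<psi>\<^sub>i\<close> folds a square into one
  with trivial left and right sides, without losing information besides the four sides. Folding turns
  a square invertible in direction \<open>i\<close> or \<open>i + 1\<close> into one invertible in direction \<open>i\<close>: if \<open>B\<close> is
  inverse to \<open>A\<close>, then \<open>\<psi>\<^sub>i A\<close> is inverse to \<open>\<psi>\<^sub>i B\<close> composed on either side with a degenerate square.
  Conversely, an inverse of \<open>\<psi>\<^sub>i A\<close> can be unfolded to an inverse of \<open>A\<close> once the relevant sides of \<open>A\<close>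
  are invertible. Directions \<open>j < i\<close> are left alone by \<open>\<psi>\<^sub>i\<close>. So while \<open>\<psi>\<^sub>n\<^sub>-\<^sub>1, \<dots>, \<psi>\<^sub>1\<close> are applied in turn,
  \<open>R\<^sub>j\<close>-invertibility of \<open>A\<close> becomes \<open>R\<^sub>1\<close>-invertibility of \<open>\<psi>\<^sub>1 \<dots> \<psi>\<^sub>n\<^sub>-\<^sub>1 A\<close>, and back, where the way back only
  uses the invertibility of faces that an invertible shell provides. Thinness passes to the inverse by
  the same induction, since the composition with degenerate squares is in a direction that the
  remaining foldings respect.
\<close>

section \<open>Double categories with connections\<close>

text \<open>Horizontal and vertical edges share one set \<open>E\<close> and one composition,
  because faces in directions \<open>i\<close> and \<open>i + 1\<close> all have dimension
  \<open>n - 1\<close>, and the remaining one of the two directions is numbered \<open>i\<close> on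
  each of them.\<close>

locale conn_square =
  fixes Q :: "'q set" and E :: "'e set" and P :: "'p set"
    and top bot left right :: "'q \<Rightarrow> 'e"
    and src tgt :: "'e \<Rightarrow> 'p"
    and pt :: "'p \<Rightarrow> 'e"
    and idv idh Gp Gm :: "'e \<Rightarrow> 'q"
    and ec :: "'e \<Rightarrow> 'e \<Rightarrow> 'e"  (infixl "\<cdot>" 75)
    and hc :: "'q \<Rightarrow> 'q \<Rightarrow> 'q"  (infixl "\<triangleright>" 70)
    and vc :: "'q \<Rightarrow> 'q \<Rightarrow> 'q"  (infixl "\<nabla>" 65)
  assumes in_E [simp]: "A \<in> Q \<Longrightarrow> top A \<in> E" "A \<in> Q \<Longrightarrow> bot A \<in> E"
      "A \<in> Q \<Longrightarrow> left A \<in> E" "A \<in> Q \<Longrightarrow> right A \<in> E"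
    and in_P [simp]: "x \<in> E \<Longrightarrow> src x \<in> P" "x \<in> E \<Longrightarrow> tgt x \<in> P"
    and pt_in [simp]: "p \<in> P \<Longrightarrow> pt p \<in> E"
    and in_Q [simp]: "x \<in> E \<Longrightarrow> idv x \<in> Q" "x \<in> E \<Longrightarrow> idh x \<in> Q"
      "x \<in> E \<Longrightarrow> Gp x \<in> Q" "x \<in> E \<Longrightarrow> Gm x \<in> Q"
    and ec_in [simp]: "x \<in> E \<Longrightarrow> y \<in> E \<Longrightarrow> tgt x = src y \<Longrightarrow> x \<cdot> y \<in> E"
    and hc_in [simp]: "A \<in> Q \<Longrightarrow> B \<in> Q \<Longrightarrow> right A = left B \<Longrightarrow> A \<triangleright> B \<in> Q"
    and vc_in [simp]: "A \<in> Q \<Longrightarrow> B \<in> Q \<Longrightarrow> bot A = top B \<Longrightarrow> A \<nabla> B \<in> Q"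
    and corners [simp]: "A \<in> Q \<Longrightarrow> src (left A) = src (top A)"
      "A \<in> Q \<Longrightarrow> src (right A) = tgt (top A)"
      "A \<in> Q \<Longrightarrow> tgt (left A) = src (bot A)"
      "A \<in> Q \<Longrightarrow> tgt (right A) = tgt (bot A)"
    and pt_faces [simp]: "p \<in> P \<Longrightarrow> src (pt p) = p" "p \<in> P \<Longrightarrow> tgt (pt p) = p"
    and idv_faces [simp]: "x \<in> E \<Longrightarrow> top (idv x) = x" "x \<in> E \<Longrightarrow> bot (idv x) = x"
      "x \<in> E \<Longrightarrow> left (idv x) = pt (src x)" "x \<in> E \<Longrightarrow> right (idv x) = pt (tgt x)"
    and idh_faces [simp]: "x \<in> E \<Longrightarrow> left (idh x) = x" "x \<in> E \<Longrightarrow> right (idh x) = x"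
      "x \<in> E \<Longrightarrow> top (idh x) = pt (src x)" "x \<in> E \<Longrightarrow> bot (idh x) = pt (tgt x)"
    and Gp_faces [simp]: "x \<in> E \<Longrightarrow> bot (Gp x) = x" "x \<in> E \<Longrightarrow> right (Gp x) = x"
      "x \<in> E \<Longrightarrow> top (Gp x) = pt (src x)" "x \<in> E \<Longrightarrow> left (Gp x) = pt (src x)"
    and Gm_faces [simp]: "x \<in> E \<Longrightarrow> top (Gm x) = x" "x \<in> E \<Longrightarrow> left (Gm x) = x"
      "x \<in> E \<Longrightarrow> bot (Gm x) = pt (tgt x)" "x \<in> E \<Longrightarrow> right (Gm x) = pt (tgt x)"
    and ec_faces [simp]: "x \<in> E \<Longrightarrow> y \<in> E \<Longrightarrow> tgt x = src y \<Longrightarrow> src (x \<cdot> y) = src x"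
      "x \<in> E \<Longrightarrow> y \<in> E \<Longrightarrow> tgt x = src y \<Longrightarrow> tgt (x \<cdot> y) = tgt y"
    and hc_faces [simp]: "A \<in> Q \<Longrightarrow> B \<in> Q \<Longrightarrow> right A = left B \<Longrightarrow> left (A \<triangleright> B) = left A"
      "A \<in> Q \<Longrightarrow> B \<in> Q \<Longrightarrow> right A = left B \<Longrightarrow> right (A \<triangleright> B) = right B"
      "A \<in> Q \<Longrightarrow> B \<in> Q \<Longrightarrow> right A = left B \<Longrightarrow> top (A \<triangleright> B) = top A \<cdot> top B"
      "A \<in> Q \<Longrightarrow> B \<in> Q \<Longrightarrow> right A = left B \<Longrightarrow> bot (A \<triangleright> B) = bot A \<cdot> bot B"
    and vc_faces [simp]: "A \<in> Q \<Longrightarrow> B \<in> Q \<Longrightarrow> bot A = top B \<Longrightarrow> top (A \<nabla> B) = top A"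
      "A \<in> Q \<Longrightarrow> B \<in> Q \<Longrightarrow> bot A = top B \<Longrightarrow> bot (A \<nabla> B) = bot B"
      "A \<in> Q \<Longrightarrow> B \<in> Q \<Longrightarrow> bot A = top B \<Longrightarrow> left (A \<nabla> B) = left A \<cdot> left B"
      "A \<in> Q \<Longrightarrow> B \<in> Q \<Longrightarrow> bot A = top B \<Longrightarrow> right (A \<nabla> B) = right A \<cdot> right B"
    and ec_assoc: "x \<in> E \<Longrightarrow> y \<in> E \<Longrightarrow> z \<in> E \<Longrightarrow> tgt x = src y \<Longrightarrow> tgt y = src z
      \<Longrightarrow> x \<cdot> y \<cdot> z = x \<cdot> (y \<cdot> z)"
    and hc_assoc: "A \<in> Q \<Longrightarrow> B \<in> Q \<Longrightarrow> D \<in> Q \<Longrightarrow> right A = left B \<Longrightarrow> right B = left D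
      \<Longrightarrow> A \<triangleright> B \<triangleright> D = A \<triangleright> (B \<triangleright> D)"
    and vc_assoc: "A \<in> Q \<Longrightarrow> B \<in> Q \<Longrightarrow> D \<in> Q \<Longrightarrow> bot A = top B \<Longrightarrow> bot B = top D
      \<Longrightarrow> A \<nabla> B \<nabla> D = A \<nabla> (B \<nabla> D)"
    and ec_unit [simp]: "x \<in> E \<Longrightarrow> p = src x \<Longrightarrow> pt p \<cdot> x = x"
      "x \<in> E \<Longrightarrow> p = tgt x \<Longrightarrow> x \<cdot> pt p = x"
    and hc_unit: "A \<in> Q \<Longrightarrow> x = left A \<Longrightarrow> idh x \<triangleright> A = A"
      "A \<in> Q \<Longrightarrow> x = right A \<Longrightarrow> A \<triangleright> idh x = A"
    and vc_unit: "A \<in> Q \<Longrightarrow> x = top A \<Longrightarrow> idv x \<nabla> A = A"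
      "A \<in> Q \<Longrightarrow> x = bot A \<Longrightarrow> A \<nabla> idv x = A"
    and interchange: "A \<in> Q \<Longrightarrow> B \<in> Q \<Longrightarrow> D \<in> Q \<Longrightarrow> F \<in> Q \<Longrightarrow> right A = left B
      \<Longrightarrow> right D = left F \<Longrightarrow> bot A = top D \<Longrightarrow> bot B = top F
      \<Longrightarrow> (A \<nabla> D) \<triangleright> (B \<nabla> F) = (A \<triangleright> B) \<nabla> (D \<triangleright> F)"
    and idv_ec: "x \<in> E \<Longrightarrow> y \<in> E \<Longrightarrow> tgt x = src y \<Longrightarrow> idv (x \<cdot> y) = idv x \<triangleright> idv y"
    and idh_pt: "p \<in> P \<Longrightarrow> idh (pt p) = idv (pt p)"
    and G_pt: "p \<in> P \<Longrightarrow> Gp (pt p) = idv (pt p)" "p \<in> P \<Longrightarrow> Gm (pt p) = idv (pt p)"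
    and Gp_ec: "x \<in> E \<Longrightarrow> y \<in> E \<Longrightarrow> tgt x = src y
      \<Longrightarrow> Gp (x \<cdot> y) = (Gp x \<nabla> idv x) \<triangleright> (idh x \<nabla> Gp y)"
    and Gm_ec: "x \<in> E \<Longrightarrow> y \<in> E \<Longrightarrow> tgt x = src y
      \<Longrightarrow> Gm (x \<cdot> y) = (Gm x \<nabla> idh y) \<triangleright> (idv y \<nabla> Gm y)"
    and transport_v: "x \<in> E \<Longrightarrow> Gp x \<nabla> Gm x = idh x"
    and transport_h: "x \<in> E \<Longrightarrow> Gp x \<triangleright> Gm x = idv x"
begin

section \<open>Folding and unfolding of squares\<close>

definition fold :: "'q \<Rightarrow> 'q" where
  "fold A = Gp (left A) \<triangleright> A \<triangleright> Gm (right A)"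

text \<open>The candidate for a square with top \<open>f\<close>, bottom \<open>g\<close>, left
  \<open>k\<close>, right \<open>h\<close> and fold \<open>U\<close>, where \<open>U\<close> has top
  \<open>f \<cdot> h\<close> and bottom \<open>k \<cdot> g\<close>: \<open>Gp h\<close> bends the
  tail of the top down into a right side, \<open>Gm k\<close> bends the head of the bottom up into a
  left side.\<close>

definition unfold :: "'e \<Rightarrow> 'e \<Rightarrow> 'e \<Rightarrow> 'e \<Rightarrow> 'q \<Rightarrow> 'q" where
  "unfold f g k h U = (idv f \<triangleright> Gp h) \<nabla> U \<nabla> (Gm k \<triangleright> idv g)"

text \<open>At a point the two identity squares coincide, so vertical ones there are also units for
  \<open>\<triangleright>\<close>. They pad rows to equal length before \<open>interchange\<close>
  is applied.\<close>

lemma hc_pt_unit [simp]: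
  "A \<in> Q \<Longrightarrow> pt p = left A \<Longrightarrow> p \<in> P \<Longrightarrow> idv (pt p) \<triangleright> A = A"
  "A \<in> Q \<Longrightarrow> pt p = right A \<Longrightarrow> p \<in> P \<Longrightarrow> A \<triangleright> idv (pt p) = A"
  by (metis hc_unit(1) idh_pt, metis hc_unit(2) idh_pt)

lemma fold_in [simp]: "A \<in> Q \<Longrightarrow> fold A \<in> Q"
  and fold_faces [simp]: "A \<in> Q \<Longrightarrow> top (fold A) = top A \<cdot> right A"
   "A \<in> Q \<Longrightarrow> bot (fold A) = left A \<cdot> bot A"
   "A \<in> Q \<Longrightarrow> left (fold A) = pt (src (top A))"
   "A \<in> Q \<Longrightarrow> right (fold A) = pt (tgt (bot A))"
  by (simp_all add: fold_def)

lemma fold_idh: "x \<in> E \<Longrightarrow> fold (idh x) = idv x"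
  by (simp add: fold_def hc_unit transport_h)

text \<open>Padded with units, the unfolding is a three by three grid. Read by columns, the outer
  ones collapse to \<open>idh\<close> by \<open>transport_v\<close>, and the middle one is
  \<open>A\<close>.\<close>

lemma unfold_fold:
  assumes A: "A \<in> Q"
  shows "unfold (top A) (bot A) (left A) (right A) (fold A) = A"
proof -
  let ?k = "left A" and ?h = "right A" and ?f = "top A" and ?g = "bot A"
  have "unfold ?f ?g ?k ?h (fold A) =
     (idv (pt (src ?k)) \<triangleright> (idv ?f \<triangleright> Gp ?h)) \<nabla> (Gp ?k \<triangleright> (A \<triangleright> Gm ?h)) \<nabla>
     (Gm ?k \<triangleright> (idv ?g \<triangleright> idv (pt (tgt ?h))))"
    using A by (simp add: unfold_def fold_def hc_assoc)
  also have "\<dots> = (idv (pt (src ?k)) \<nabla> Gp ?k \<nabla> Gm ?k) \<triangleright>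
     ((idv ?f \<nabla> A \<nabla> idv ?g) \<triangleright> (Gp ?h \<nabla> Gm ?h \<nabla> idv (pt (tgt ?h))))"
    using A by (simp add: interchange)
  also have "\<dots> = A"
    using A by (simp add: vc_unit hc_unit transport_v)
  finally show ?thesis .
qed

text \<open>Compositions are total functions, so the fact that the rows of the unfolding fit
  together is recorded for arguments that treat them one by one.\<close>

lemma unfold_fold_composable:
  fixes A
  defines "T \<equiv> idv (top A) \<triangleright> Gp (right A)" and "S \<equiv> Gm (left A) \<triangleright> idv (bot A)"
  assumes "A \<in> Q"
  shows "right (idv (top A)) = left (Gp (right A))" "right (Gm (left A)) = left (idv (bot A))"
    "T \<in> Q" "S \<in> Q" "T \<nabla> fold A \<in> Q" "bot T = top (fold A)" "bot (T \<nabla> fold A) = top S"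
  using assms(3) by (simp_all add: T_def S_def)

text \<open>The grid argument with rows and columns exchanged: \<open>transport_h\<close> turns the
  outer rows into identities on \<open>f \<cdot> h\<close> and \<open>k \<cdot> g\<close>.\<close>

lemma fold_unfold:
  assumes "f \<in> E" "g \<in> E" "k \<in> E" "h \<in> E" "U \<in> Q" "top U = f \<cdot> h" "bot U = k \<cdot> g"
    "left U = pt (src f)" "right U = pt (tgt g)"
    "tgt f = src h" "tgt k = src g" "src f = src k" "tgt h = tgt g"
  shows "unfold f g k h U \<in> Q" "top (unfold f g k h U) = f" "bot (unfold f g k h U) = g"
    "left (unfold f g k h U) = k" "right (unfold f g k h U) = h"
    "fold (unfold f g k h U) = U"
proof -
  show in': "unfold f g k h U \<in> Q" "top (unfold f g k h U) = f" "bot (unfold f g k h U) = g"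
     "left (unfold f g k h U) = k" "right (unfold f g k h U) = h"
    using assms by (simp_all add: unfold_def)
  have "fold (unfold f g k h U) =
     (idv (pt (src k)) \<nabla> idv (pt (src k)) \<nabla> Gp k) \<triangleright>
     ((idv f \<triangleright> Gp h) \<nabla> U \<nabla> (Gm k \<triangleright> idv g)) \<triangleright> (Gm h \<nabla> idv (pt (tgt h)) \<nabla> idv (pt (tgt h)))"
    using assms in' by (simp add: fold_def unfold_def vc_unit)
  also have "\<dots> = (idv f \<triangleright> (Gp h \<triangleright> Gm h)) \<nabla> U \<nabla> (Gp k \<triangleright> Gm k \<triangleright> idv g)"
    using assms by (simp add: interchange hc_assoc)
  also have "\<dots> = U"
    using assms by (simp add: transport_h idv_ec[symmetric] vc_unit)
  finally show "fold (unfold f g k h U) = U" .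
qed

text \<open>Between \<open>A\<close> and \<open>B\<close> the identity on their common side is
  inserted as \<open>Gp \<nabla> Gm\<close>. Interchange then splits the result into two rows: the
  lower half closes off \<open>A\<close>, the upper half \<open>B\<close>.\<close>

lemma fold_hc:
  assumes "A \<in> Q" "B \<in> Q" "right A = left B"
  shows "fold (A \<triangleright> B) = (idv (top A) \<triangleright> fold B) \<nabla> (fold A \<triangleright> idv (bot B))"
proof -
  have [simp]: "tgt (top A) = src (top B)" "tgt (bot A) = src (bot B)"
    using assms corners by metis+
  have "fold (A \<triangleright> B) = (idv (pt (src (top A))) \<nabla> Gp (left A)) \<triangleright> ((idv (top A) \<nabla> A) \<triangleright>
     ((Gp (left B) \<nabla> Gm (right A)) \<triangleright> ((B \<nabla> idv (bot B)) \<triangleright> (Gm (right B) \<nabla> idv (pt (tgt (bot B)))))))"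
    using assms by (simp add: fold_def hc_assoc vc_unit hc_unit transport_v)
  also have "\<dots> = (idv (top A) \<triangleright> fold B) \<nabla> (fold A \<triangleright> idv (bot B))"
    using assms by (simp add: interchange fold_def hc_assoc)
  finally show ?thesis .
qed

section \<open>Invertible edges and squares\<close>

definition einv :: "'e \<Rightarrow> 'e \<Rightarrow> bool" where
  "einv x y \<longleftrightarrow> x \<in> E \<and> y \<in> E \<and> tgt x = src y \<and> tgt y = src x \<and>
     x \<cdot> y = pt (src x) \<and> y \<cdot> x = pt (tgt x)"

definition hinv :: "'q \<Rightarrow> 'q \<Rightarrow> bool" where
  "hinv A B \<longleftrightarrow> A \<in> Q \<and> B \<in> Q \<and> right A = left B \<and> right B = left A \<and>
     A \<triangleright> B = idh (left A) \<and> B \<triangleright> A = idh (right A)"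

definition vinv :: "'q \<Rightarrow> 'q \<Rightarrow> bool" where
  "vinv A B \<longleftrightarrow> A \<in> Q \<and> B \<in> Q \<and> bot A = top B \<and> bot B = top A \<and>
     A \<nabla> B = idv (top A) \<and> B \<nabla> A = idv (bot A)"

lemma vinv_sides:
  assumes "vinv A B"
  shows "einv (left A) (left B)" "einv (right A) (right B)"
proof -
  have *: "A \<in> Q" "B \<in> Q" "bot A = top B" "bot B = top A"
     "A \<nabla> B = idv (top A)" "B \<nabla> A = idv (bot A)"
    using assms by (simp_all add: vinv_def)
  show "einv (left A) (left B)"
    using * vc_faces(3)[of A B] vc_faces(3)[of B A] by (simp add: einv_def)
  show "einv (right A) (right B)"
    using * vc_faces(4)[of A B] vc_faces(4)[of B A] by (simp add: einv_def)
qed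

lemma hinv_sides:
  assumes "hinv A B"
  shows "einv (top A) (top B)" "einv (bot A) (bot B)"
proof -
  have *: "A \<in> Q" "B \<in> Q" "right A = left B" "right B = left A"
     "A \<triangleright> B = idh (left A)" "B \<triangleright> A = idh (right A)"
    using assms by (simp_all add: hinv_def)
  have c: "tgt (top A) = src (top B)" "tgt (bot A) = src (bot B)"
    "tgt (top B) = src (top A)" "tgt (bot B) = src (bot A)"
    using * corners by metis+
  show "einv (top A) (top B)"
    using * c hc_faces(3)[of A B] hc_faces(3)[of B A] by (simp add: einv_def)
  show "einv (bot A) (bot B)"
    using * c hc_faces(4)[of A B] hc_faces(4)[of B A] by (simp add: einv_def)
qed

text \<open>Forces an inverse of a folded square to have trivial left and right sides as
  well.\<close>

lemma einv_pt: "einv (pt p) y \<Longrightarrow> p \<in> P \<Longrightarrow> y = pt p"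
  using ec_unit(1)[of y p] pt_faces(1)[of p] pt_faces(2)[of p] unfolding einv_def by argo

lemma fold_inj:
  assumes "A \<in> Q" "B \<in> Q" "top A = top B" "bot A = bot B" "left A = left B" "right A = right B"
    "fold A = fold B"
  shows "A = B"
  using assms unfold_fold by metis

lemma vinv_idv: "x \<in> E \<Longrightarrow> vinv (idv x) (idv x)"
  by (simp add: vinv_def vc_unit)

lemma vinv_hc:
  assumes "vinv A B" "vinv D F" "right A = left D" "right B = left F"
  shows "vinv (A \<triangleright> D) (B \<triangleright> F)"
proof -
  have *: "A \<in> Q" "B \<in> Q" "bot A = top B" "bot B = top A"
     "A \<nabla> B = idv (top A)" "B \<nabla> A = idv (bot A)"
     "D \<in> Q" "F \<in> Q" "bot D = top F" "bot F = top D"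
     "D \<nabla> F = idv (top D)" "F \<nabla> D = idv (bot D)"
    using assms by (simp_all add: vinv_def)
  have c: "tgt (top A) = src (top D)" "tgt (top B) = src (top F)"
    using * assms(3,4) corners by metis+
  show ?thesis
    using * c assms(3,4) interchange[of A D B F] interchange[of B F A D]
    by (simp add: vinv_def idv_ec)
qed

lemma vinv_vc:
  assumes "vinv A B" "vinv D F" "bot A = top D"
  shows "vinv (A \<nabla> D) (F \<nabla> B)"
proof -
  have *: "A \<in> Q" "B \<in> Q" "bot A = top B" "bot B = top A"
     "A \<nabla> B = idv (top A)" "B \<nabla> A = idv (bot A)"
     "D \<in> Q" "F \<in> Q" "bot D = top F" "bot F = top D"
     "D \<nabla> F = idv (top D)" "F \<nabla> D = idv (bot D)"
    using assms by (simp_all add: vinv_def)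
  have "A \<nabla> D \<nabla> (F \<nabla> B) = A \<nabla> (D \<nabla> F \<nabla> B)" "F \<nabla> B \<nabla> (A \<nabla> D) = F \<nabla> (B \<nabla> A \<nabla> D)"
    using *(1-4,7-10) assms(3) by (simp_all add: vc_assoc)
  then show ?thesis
    using * assms(3) by (simp add: vinv_def vc_unit)
qed

text \<open>One composite is \<open>Gp (x \<cdot> y)\<close> by \<open>Gp_ec\<close>, the connection
  on a point and hence an identity. For the other, the trivial square
  \<open>Gp (y \<cdot> x)\<close> is placed beside \<open>idv x\<close> and expanded, after which
  \<open>x \<cdot> y\<close> cancels.\<close>

lemma vinv_Gp:
  assumes "einv x y"
  shows "vinv (Gp x) (idv x \<triangleright> Gp y)"
proof -
  have *: "x \<in> E" "y \<in> E" "tgt x = src y" "tgt y = src x" "x \<cdot> y = pt (src x)" "y \<cdot> x = pt (src y)"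
    using assms by (simp_all add: einv_def)
  have 1: "Gp x \<nabla> (idv x \<triangleright> Gp y) = Gp (x \<cdot> y)"
    using *(1-4) by (simp add: Gp_ec interchange hc_unit)
  have "idv x = (idv x \<nabla> idv x) \<triangleright> Gp (y \<cdot> x)"
    using * by (simp add: G_pt vc_unit)
  also have "\<dots> = (idv x \<nabla> idv x) \<triangleright> (Gp y \<nabla> (idv y \<triangleright> Gp x))"
    using *(1-4) by (simp add: Gp_ec interchange hc_unit)
  also have "\<dots> = (idv x \<triangleright> Gp y) \<nabla> (idv (x \<cdot> y) \<triangleright> Gp x)"
    using *(1-4) by (simp add: interchange idv_ec hc_assoc)
  also have "\<dots> = (idv x \<triangleright> Gp y) \<nabla> Gp x"
    using * by simp
  finally have "(idv x \<triangleright> Gp y) \<nabla> Gp x = idv x" ..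
  with 1 * show ?thesis by (simp add: vinv_def G_pt)
qed

lemma vinv_Gm:
  assumes "einv x y"
  shows "vinv (Gm x) (Gm y \<triangleright> idv x)"
proof -
  have *: "x \<in> E" "y \<in> E" "tgt x = src y" "tgt y = src x" "x \<cdot> y = pt (src x)" "y \<cdot> x = pt (src y)"
    using assms by (simp_all add: einv_def)
  have 1: "(Gm y \<triangleright> idv x) \<nabla> Gm x = Gm (y \<cdot> x)"
    using *(1-4) by (simp add: Gm_ec interchange hc_unit)
  have "idv x = Gm (x \<cdot> y) \<triangleright> (idv x \<nabla> idv x)"
    using * by (simp add: G_pt vc_unit)
  also have "\<dots> = ((Gm x \<triangleright> idv y) \<nabla> Gm y) \<triangleright> (idv x \<nabla> idv x)"
    using *(1-4) by (simp add: Gm_ec interchange hc_unit)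
  also have "\<dots> = (Gm x \<triangleright> idv (y \<cdot> x)) \<nabla> (Gm y \<triangleright> idv x)"
    using *(1-4) by (simp add: interchange idv_ec hc_assoc)
  also have "\<dots> = Gm x \<nabla> (Gm y \<triangleright> idv x)"
    using * by simp
  finally have "Gm x \<nabla> (Gm y \<triangleright> idv x) = idv x" ..
  with 1 * show ?thesis by (simp add: vinv_def G_pt)
qed

text \<open>Each of the three factors of \<open>fold A\<close> is vertically invertible, the
  connections because the sides of \<open>A\<close> are; reassociating the inverses assembles
  \<open>fold B\<close> between two identities.\<close>

lemma vinv_fold:
  assumes "vinv A B"
  shows "vinv (fold A) (idv (left A) \<triangleright> fold B \<triangleright> idv (right A))"
proof -
  note l = vinv_sides(1)[OF assms] and r = vinv_sides(2)[OF assms]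
  have *: "A \<in> Q" "B \<in> Q" using assms by (simp_all add: vinv_def)
  have c: "tgt (left A) = src (left B)" "tgt (right A) = src (right B)"
    "tgt (left B) = src (left A)" "tgt (right B) = src (right A)"
    using l r by (simp_all only: einv_def)
  have "vinv (Gp (left A) \<triangleright> A \<triangleright> Gm (right A))
     (idv (left A) \<triangleright> Gp (left B) \<triangleright> B \<triangleright> (Gm (right B) \<triangleright> idv (right A)))"
    by (intro vinv_hc vinv_Gp vinv_Gm l r assms) (use * c in simp_all)
  also have "idv (left A) \<triangleright> Gp (left B) \<triangleright> B \<triangleright> (Gm (right B) \<triangleright> idv (right A))
     = idv (left A) \<triangleright> fold B \<triangleright> idv (right A)"
    using * c by (simp add: fold_def hc_assoc)
  finally show ?thesis by (simp add: fold_def)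
qed

lemma vinv_fold_composable:
  assumes "vinv A B"
  shows "right (idv (left A)) = left (fold B)" "right (idv (left A) \<triangleright> fold B) = left (idv (right A))"
proof -
  show 1: "right (idv (left A)) = left (fold B)"
    using assms by (simp add: vinv_def)
  have *: "A \<in> Q" "B \<in> Q" "bot B = top A" using assms by (simp_all add: vinv_def)
  show "right (idv (left A) \<triangleright> fold B) = left (idv (right A))"
    by (subst hc_faces(2)[OF _ _ 1]) (use * in simp_all)
qed

text \<open>Unfolding exhibits \<open>A\<close> as three rows: the outer ones consist of identities
  and connections on invertible sides, the middle one is \<open>fold A\<close>.\<close>

lemma vinv_if_vinv_fold:
  assumes "A \<in> Q" "einv (left A) k" "einv (right A) h" "vinv (fold A) U"
  shows "\<exists>B. vinv A B"
proof -
  have "vinv (idv (top A) \<triangleright> Gp (right A)) (idv (top A) \<triangleright> (idv (right A) \<triangleright> Gp h))"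
    "vinv (Gm (left A) \<triangleright> idv (bot A)) (Gm k \<triangleright> idv (left A) \<triangleright> idv (bot A))"
    by (intro vinv_hc vinv_idv vinv_Gp vinv_Gm assms; use assms in \<open>simp add: einv_def\<close>)+
  then have "\<exists>B. vinv (unfold (top A) (bot A) (left A) (right A) (fold A)) B"
    unfolding unfold_def using assms(4)
    by (intro exI) (rule vinv_vc, rule vinv_vc, assumption+, use assms in simp_all)
  then show ?thesis using assms(1) by (simp add: unfold_fold)
qed

text \<open>Applied to the identities \<open>A \<triangleright> B\<close> and
  \<open>B \<triangleright> A\<close>, \<open>fold_hc\<close> gives two equations between
  \<open>fold A\<close> and \<open>fold B\<close> with identities attached. Attaching
  \<open>idv (bot A)\<close> on the right of the first and \<open>idv (top A)\<close> on the left of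
  the second cancels those next to \<open>fold A\<close>.\<close>

lemma hinv_fold:
  assumes "hinv A B"
  shows "vinv (fold A) (idv (top A) \<triangleright> fold B \<triangleright> idv (bot A))"
proof -
  have *: "A \<in> Q" "B \<in> Q" "right A = left B" "right B = left A"
     "A \<triangleright> B = idh (left A)" "B \<triangleright> A = idh (left B)"
    using assms by (simp_all add: hinv_def)
  have e: "tgt (top A) = src (top B)" "tgt (bot A) = src (bot B)"
    "tgt (top B) = src (top A)" "tgt (bot B) = src (bot A)"
    "top A \<cdot> top B = pt (src (top A))" "bot B \<cdot> bot A = pt (src (bot B))"
    using hinv_sides[OF assms] by (simp_all add: einv_def)
  have 1: "(idv (top A) \<triangleright> fold B) \<nabla> (fold A \<triangleright> idv (bot B)) = idv (left A)"
    using fold_hc[of A B] * by (simp add: fold_idh)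
  have 2: "(idv (top B) \<triangleright> fold A) \<nabla> (fold B \<triangleright> idv (bot A)) = idv (left B)"
    using fold_hc[of B A] * by (simp add: fold_idh)
  have "(idv (top A) \<triangleright> fold B \<triangleright> idv (bot A)) \<nabla> fold A =
    ((idv (top A) \<triangleright> fold B) \<nabla> (fold A \<triangleright> idv (bot B))) \<triangleright> (idv (bot A) \<nabla> idv (bot A))"
    using *(1-4) e by (subst interchange) (simp_all add: hc_assoc ec_assoc idv_ec[symmetric])
  also have "\<dots> = idv (left A \<cdot> bot A)"
    using * e 1 by (simp add: vc_unit idv_ec)
  finally have 3: "(idv (top A) \<triangleright> fold B \<triangleright> idv (bot A)) \<nabla> fold A = idv (left A \<cdot> bot A)" .
  have "fold A \<nabla> (idv (top A) \<triangleright> fold B \<triangleright> idv (bot A)) =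
    (idv (top A) \<nabla> idv (top A)) \<triangleright> ((idv (top B) \<triangleright> fold A) \<nabla> (fold B \<triangleright> idv (bot A)))"
    using *(1-4) e by (subst interchange) (simp_all add: hc_assoc[symmetric] ec_assoc idv_ec[symmetric])
  also have "\<dots> = idv (top A \<cdot> right A)"
    using * e 2 by (simp add: vc_unit idv_ec)
  finally have 4: "fold A \<nabla> (idv (top A) \<triangleright> fold B \<triangleright> idv (bot A)) = idv (top A \<cdot> right A)" .
  have "top A \<cdot> (top B \<cdot> (left A \<cdot> bot A)) = left A \<cdot> bot A"
    using * e ec_assoc[of "top A" "top B" "left A \<cdot> bot A"] by simp
  with 3 4 * e show ?thesis
    by (simp add: vinv_def ec_assoc)
qed

lemma hinv_fold_composable:
  assumes "hinv A B"
  shows "right (idv (top A)) = left (fold B)" "right (idv (top A) \<triangleright> fold B) = left (idv (bot A))"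
proof -
  have *: "A \<in> Q" "B \<in> Q" "right A = left B" "right B = left A"
    using assms by (simp_all add: hinv_def)
  then have e: "tgt (top A) = src (top B)" "tgt (bot B) = src (bot A)"
    using hinv_sides[OF assms] by (simp_all add: einv_def)
  then show 1: "right (idv (top A)) = left (fold B)"
    using * by simp
  show "right (idv (top A) \<triangleright> fold B) = left (idv (bot A))"
    by (subst hc_faces(2)[OF _ _ 1]) (use * e in simp_all)
qed

lemma hinv_if_vinv_fold:
  assumes "A \<in> Q" "einv (top A) f" "einv (bot A) g" "vinv (fold A) U"
  shows "\<exists>B. hinv A B"
proof -
  note [simp] = assms(1)
  have e: "f \<in> E" "g \<in> E" "tgt (top A) = src f" "tgt (bot A) = src g" "tgt f = src (top A)"
    "tgt g = src (bot A)" "top A \<cdot> f = pt (src (top A))" "bot A \<cdot> g = pt (src (bot A))"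
    "f \<cdot> top A = pt (src f)" "g \<cdot> bot A = pt (src g)"
    using assms by (simp_all add: einv_def)
  have U: "U \<in> Q" "top U = left A \<cdot> bot A" "bot U = top A \<cdot> right A"
     "U \<nabla> fold A = idv (left A \<cdot> bot A)" "fold A \<nabla> U = idv (top A \<cdot> right A)"
    using assms(4) by (simp_all add: vinv_def)
  have lU: "left U = pt (src (top A))" "right U = pt (tgt (bot A))"
    using vinv_sides[OF assms(4)] by (simp_all add: einv_pt)
  \<comment> \<open>By uniqueness of inverses, \<open>hinv_fold\<close> would make \<open>U\<close>
    equal to \<open>idv (top A) \<triangleright> fold B \<triangleright> idv (bot A)\<close> for an
    inverse \<open>B\<close>. Solving for \<open>fold B\<close> gives \<open>?V\<close>, which is
    unfolded with the left and right sides of \<open>A\<close> exchanged.\<close>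
  let ?V = "idv f \<triangleright> U \<triangleright> idv g"
  let ?B = "unfold f g (right A) (left A) ?V"
  have top_bot: "f \<cdot> (top A \<cdot> right A) = right A" "left A \<cdot> bot A \<cdot> g = left A"
    using e ec_assoc[of f "top A" "right A"] by (simp_all add: ec_assoc)
  have "f \<cdot> (left A \<cdot> bot A) \<cdot> g = f \<cdot> left A"
    using e top_bot(2) by (simp add: ec_assoc)
  then have V: "?V \<in> Q" "top ?V = f \<cdot> left A" "bot ?V = right A \<cdot> g"
    "left ?V = pt (src f)" "right ?V = pt (tgt g)"
    using e U lU top_bot by simp_all
  have B: "?B \<in> Q" "top ?B = f" "bot ?B = g" "left ?B = right A" "right ?B = left A" "fold ?B = ?V"
    using e V by (simp_all add: fold_unfold)
  have "idv (top A) \<triangleright> ?V = U \<triangleright> idv g"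
    using e U lU by (simp flip: hc_assoc) (simp flip: idv_ec)
  then have "fold (A \<triangleright> ?B) = (U \<nabla> fold A) \<triangleright> (idv g \<nabla> idv g)"
    using e U lU B fold_hc[of A ?B] interchange[of U "idv g" "fold A" "idv g"] by simp
  also have "\<dots> = fold (idh (left A))"
    using e U top_bot by (simp add: vc_unit fold_idh flip: idv_ec)
  \<comment> \<open>The sides of both squares agree, so \<open>fold_inj\<close> allows the equation
    to be checked after folding.\<close>
  finally have 1: "A \<triangleright> ?B = idh (left A)"
    using e B by - (rule fold_inj, simp_all)
  have "?V \<triangleright> idv (bot A) = idv f \<triangleright> U"
    using e U lU by (simp add: hc_assoc) (simp flip: idv_ec)
  then have "fold (?B \<triangleright> A) = (idv f \<nabla> idv f) \<triangleright> (fold A \<nabla> U)"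
    using e U lU B fold_hc[of ?B A] interchange[of "idv f" "fold A" "idv f" U] by simp
  also have "\<dots> = fold (idh (right A))"
    using e U top_bot by (simp add: vc_unit fold_idh flip: idv_ec)
  finally have 2: "?B \<triangleright> A = idh (right A)"
    using e B by - (rule fold_inj, simp_all)
  from 1 2 B show ?thesis
    by (intro exI[of _ ?B]) (simp add: hinv_def)
qed

end

section \<open>Cells with an R-inverse\<close>

text \<open>Dimensions appear as \<open>n - 1\<close> in all the axioms; as \<open>n - Suc 0\<close> they would not match.\<close>
declare One_nat_def [simp del]

lemma is_R_inverse_sym: "is_R_inverse C n k A B \<longleftrightarrow> is_R_inverse C n k B A"
  by (auto simp: is_R_inverse_def composable_def)

context cubical_omega_category
begin

lemma face_face_neq:
  assumes "A \<in> cells C n" "1 \<le> i" "i \<le> n" "1 \<le> j" "j \<le> n" "i \<noteq> j"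
  shows "face C (n - 1) (lower j i) \<alpha> (face C n i \<beta> A)
    = face C (n - 1) (lower i j) \<beta> (face C n j \<alpha> A)"
  using assms face_face[of A n i j \<alpha> \<beta>] face_face[of A n j i \<beta> \<alpha>]
  by (cases "i < j") (simp_all add: lower_def)

lemma face_degen_raise:
  assumes "A \<in> cells C n" "1 \<le> i" "i \<le> n + 1" "1 \<le> j" "j \<le> n"
  shows "face C (n + 1) (raise j i) \<alpha> (degen C n i A)
    = degen C (n - 1) (lower i (raise j i)) (face C n j \<alpha> A)"
  using assms face_degen_neq[of A n "raise j i" i \<alpha>] by (auto simp: raise_def lower_def)

lemma degen_degen_raise:
  assumes "A \<in> cells C (n - 1)" "1 \<le> i" "i \<le> n + 1" "1 \<le> j" "j \<le> n"
  shows "degen C n i (degen C (n - 1) j A)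
    = degen C n (raise j i) (degen C (n - 1) (lower i (raise j i)) A)"
  using assms degen_degen[of A "n - 1" i j] degen_degen[of A "n - 1" j "i - 1"]
  by (auto simp: raise_def lower_def)

lemma face_conn_raise:
  assumes "A \<in> cells C n" "1 \<le> i" "i \<le> n" "1 \<le> j" "j \<le> n" "i \<noteq> j"
  shows "face C (n + 1) (raise j i) \<alpha> (conn C n i \<beta> A)
    = conn C (n - 1) (lower i j) \<beta> (face C n j \<alpha> A)"
  using assms face_conn_neq[of A n "raise j i" i \<alpha> \<beta>] by (auto simp: raise_def lower_def)

section \<open>Uniqueness and stability of R-inverses\<close>

lemma R_inverse_unique:
  assumes "is_R_inverse C n k A B" "is_R_inverse C n k A B'" "1 \<le> k" "k \<le> n"
  shows "B = B'"
proof -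
  have *: "A \<in> cells C n" "B \<in> cells C n" "B' \<in> cells C n" "face C n k Plus A = face C n k Minus B"
     "face C n k Plus A = face C n k Minus B'" "face C n k Plus B = face C n k Minus A"
     "face C n k Plus B' = face C n k Minus A"
     "pcomp C n k B A = degen C (n - 1) k (face C n k Plus A)"
     "pcomp C n k A B' = degen C (n - 1) k (face C n k Minus A)"
    using assms by (simp_all add: is_R_inverse_def composable_def)
  have "B = pcomp C n k B (pcomp C n k A B')"
    using * assms pcomp_unit_right[of B n k] by simp
  also have "\<dots> = pcomp C n k (pcomp C n k B A) B'"
    using * assms by (intro pcomp_assoc[symmetric]) (simp_all add: composable_def)
  also have "\<dots> = B'"
    using * assms pcomp_unit_left[of B' n k] by simp
  finally show ?thesis .
qed

lemma composable_face:
  assumes "composable C n j A B" "1 \<le> j" "j \<le> n" "1 \<le> k" "k \<le> n" "j \<noteq> k"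
  shows "composable C (n - 1) (lower j k) (face C n k \<alpha> A) (face C n k \<alpha> B)"
  using assms by (simp add: composable_def face_closed face_face_neq[of _ n k j])

lemma composable_degen:
  assumes "composable C n j A B" "1 \<le> j" "j \<le> n" "1 \<le> i" "i \<le> n + 1"
  shows "composable C (n + 1) (raise j i) (degen C n i A) (degen C n i B)"
  using assms degen_closed face_degen_raise by (simp add: composable_def)

lemma composable_conn:
  assumes "composable C n j A B" "1 \<le> j" "j \<le> n" "1 \<le> i" "i \<le> n" "i \<noteq> j"
  shows "composable C (n + 1) (raise j i) (conn C n i \<alpha> A) (conn C n i \<alpha> B)"
  using assms conn_closed face_conn_raise by (simp add: composable_def)

lemma lower_bounds:
  assumes "1 \<le> j" "j \<le> n" "1 \<le> k" "k \<le> n" "j \<noteq> k"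
  shows "1 \<le> lower j k" "lower j k \<le> n - 1"
  using assms by (auto simp: lower_def)

lemma R_inverse_face:
  assumes "is_R_inverse C n j A B" "1 \<le> j" "j \<le> n" "1 \<le> k" "k \<le> n" "j \<noteq> k"
  shows "is_R_inverse C (n - 1) (lower j k) (face C n k \<alpha> A) (face C n k \<alpha> B)"
proof -
  \<comment> \<open>Proved for an arbitrary inverse pair and used in both orders: the second
    equation of \<open>is_R_inverse\<close> is the first one for the exchanged pair, since
    composability equates the faces involved.\<close>
  have *: "composable C (n - 1) (lower j k) (face C n k \<alpha> A) (face C n k \<alpha> B) \<and>
     pcomp C (n - 1) (lower j k) (face C n k \<alpha> A) (face C n k \<alpha> B) =
     degen C (n - 1 - 1) (lower j k) (face C (n - 1) (lower j k) Minus (face C n k \<alpha> A))"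
    if "is_R_inverse C n j A B" for A B
  proof
    have AB: "composable C n j A B" "A \<in> cells C n"
      "pcomp C n j A B = degen C (n - 1) j (face C n j Minus A)"
      using that by (simp_all add: is_R_inverse_def composable_def)
    show "composable C (n - 1) (lower j k) (face C n k \<alpha> A) (face C n k \<alpha> B)"
      using AB assms(2-) by (intro composable_face)
    have "pcomp C (n - 1) (lower j k) (face C n k \<alpha> A) (face C n k \<alpha> B)
      = face C n k \<alpha> (degen C (n - 1) j (face C n j Minus A))"
      using face_pcomp_neq[of n j A B k \<alpha>] AB assms(2-) by simp
    also have "\<dots> = degen C (n - 1 - 1) (lower j k) (face C (n - 1) (lower k j) \<alpha> (face C n j Minus A))"
      using face_degen_neq[of "face C n j Minus A" "n - 1" k j \<alpha>] face_closed[of A n j Minus] AB assms(2-)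
      by simp
    finally show "pcomp C (n - 1) (lower j k) (face C n k \<alpha> A) (face C n k \<alpha> B) =
     degen C (n - 1 - 1) (lower j k) (face C (n - 1) (lower j k) Minus (face C n k \<alpha> A))"
      using AB assms(2-) by (simp add: face_face_neq)
  qed
  have "is_R_inverse C n j B A" "composable C n j A B"
    using assms(1) by (simp_all add: is_R_inverse_def composable_def)
  with *[OF assms(1)] *[of B A] composable_face[of n j A B k \<alpha>] assms(2-) show ?thesis
    by (simp add: is_R_inverse_def composable_def)
qed

lemma R_inverse_degen:
  assumes "is_R_inverse C n j A B" "1 \<le> j" "j \<le> n" "1 \<le> i" "i \<le> n + 1"
  shows "is_R_inverse C (n + 1) (raise j i) (degen C n i A) (degen C n i B)"
proof -
  have *: "composable C (n + 1) (raise j i) (degen C n i A) (degen C n i B) \<and>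
     pcomp C (n + 1) (raise j i) (degen C n i A) (degen C n i B) =
     degen C n (raise j i) (face C (n + 1) (raise j i) Minus (degen C n i A))"
    if "is_R_inverse C n j A B" for A B
  proof
    have AB: "composable C n j A B" "A \<in> cells C n"
      "pcomp C n j A B = degen C (n - 1) j (face C n j Minus A)"
      using that by (simp_all add: is_R_inverse_def composable_def)
    show "composable C (n + 1) (raise j i) (degen C n i A) (degen C n i B)"
      using AB assms(2-) by (intro composable_degen)
    have "pcomp C (n + 1) (raise j i) (degen C n i A) (degen C n i B)
      = degen C n i (degen C (n - 1) j (face C n j Minus A))"
      using degen_pcomp[of n j A B i] AB assms(2-) by simp
    also have "\<dots> = degen C n (raise j i) (degen C (n - 1) (lower i (raise j i)) (face C n j Minus A))"
      using degen_degen_raise face_closed AB assms(2-) by simp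
    finally show "pcomp C (n + 1) (raise j i) (degen C n i A) (degen C n i B) =
     degen C n (raise j i) (face C (n + 1) (raise j i) Minus (degen C n i A))"
      using face_degen_raise AB assms(2-) by simp
  qed
  have "is_R_inverse C n j B A" "composable C n j A B"
    using assms(1) by (simp_all add: is_R_inverse_def composable_def)
  with *[OF assms(1)] *[of B A] assms(2-) show ?thesis
    by (simp add: is_R_inverse_def composable_def)
qed

lemma R_inverse_conn:
  assumes "is_R_inverse C n j A B" "1 \<le> j" "j \<le> n" "1 \<le> i" "i \<le> n" "i \<noteq> j"
  shows "is_R_inverse C (n + 1) (raise j i) (conn C n i \<alpha> A) (conn C n i \<alpha> B)"
proof -
  have *: "composable C (n + 1) (raise j i) (conn C n i \<alpha> A) (conn C n i \<alpha> B) \<and>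
     pcomp C (n + 1) (raise j i) (conn C n i \<alpha> A) (conn C n i \<alpha> B) =
     degen C n (raise j i) (face C (n + 1) (raise j i) Minus (conn C n i \<alpha> A))"
    if "is_R_inverse C n j A B" for A B
  proof
    have AB: "composable C n j A B" "A \<in> cells C n"
      "pcomp C n j A B = degen C (n - 1) j (face C n j Minus A)"
      using that by (simp_all add: is_R_inverse_def composable_def)
    show "composable C (n + 1) (raise j i) (conn C n i \<alpha> A) (conn C n i \<alpha> B)"
      using AB assms(2-) by (intro composable_conn)
    have "pcomp C (n + 1) (raise j i) (conn C n i \<alpha> A) (conn C n i \<alpha> B)
      = conn C n i \<alpha> (degen C (n - 1) j (face C n j Minus A))"
      using conn_pcomp_neq[of n j A B i] AB assms(2-) by simp
    also have "\<dots> = degen C n (raise j i) (conn C (n - 1) (lower i j) \<alpha> (face C n j Minus A))"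
      using conn_degen_neq[of "face C n j Minus A" "n - 1" i j] face_closed[of A n j] AB assms(2-) by simp
    finally show "pcomp C (n + 1) (raise j i) (conn C n i \<alpha> A) (conn C n i \<alpha> B) =
     degen C n (raise j i) (face C (n + 1) (raise j i) Minus (conn C n i \<alpha> A))"
      using face_conn_raise AB assms(2-) by simp
  qed
  have "is_R_inverse C n j B A" "composable C n j A B"
    using assms(1) by (simp_all add: is_R_inverse_def composable_def)
  with *[OF assms(1)] *[of B A] assms(2-) show ?thesis
    by (simp add: is_R_inverse_def composable_def)
qed

lemma R_inverse_pcomp:
  assumes AB: "is_R_inverse C n j A B" and DF: "is_R_inverse C n j D F" and AD: "composable C n i A D"
    and ij: "1 \<le> j" "j \<le> n" "1 \<le> i" "i \<le> n" "i \<noteq> j"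
  shows "composable C n i B F" "is_R_inverse C n j (pcomp C n i A D) (pcomp C n i B F)"
proof -
  have cells: "A \<in> cells C n" "B \<in> cells C n" "D \<in> cells C n" "F \<in> cells C n"
    using AB DF by (simp_all add: is_R_inverse_def composable_def)
  \<comment> \<open>By \<open>R_inverse_face\<close> these faces of \<open>B\<close> and
    \<open>F\<close> are inverses of the common face of \<open>A\<close> and \<open>D\<close>, so
    uniqueness applies.\<close>
  have "face C n i Plus B = face C n i Minus F"
    using R_inverse_face[OF AB, of i Plus] R_inverse_face[OF DF, of i Minus] AD ij
      lower_bounds[of j n i] R_inverse_unique
    by (simp add: composable_def)
  with cells show BF: "composable C n i B F" by (simp add: composable_def)
  have *: "composable C n j (pcomp C n i A D) (pcomp C n i B F) \<and>
    pcomp C n j (pcomp C n i A D) (pcomp C n i B F) =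
      degen C (n - 1) j (face C n j Minus (pcomp C n i A D))"
    if AB: "is_R_inverse C n j A B" and DF: "is_R_inverse C n j D F" and AD: "composable C n i A D"
      and BF: "composable C n i B F" for A B D F
  proof
    have AB': "composable C n j A B" "pcomp C n j A B = degen C (n - 1) j (face C n j Minus A)"
      and DF': "composable C n j D F" "pcomp C n j D F = degen C (n - 1) j (face C n j Minus D)"
      using AB DF by (simp_all add: is_R_inverse_def)
    show "composable C n j (pcomp C n i A D) (pcomp C n i B F)"
      using AB' DF' AD BF ij
      by (simp add: composable_def[of _ _ j] pcomp_closed face_pcomp_neq)
    have l: "1 \<le> lower i j" "lower i j \<le> n - 1" "raise (lower i j) j = i"
      using ij by (auto simp: lower_def raise_def)
    have "pcomp C n j (pcomp C n i A D) (pcomp C n i B F)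
      = pcomp C n i (degen C (n - 1) j (face C n j Minus A)) (degen C (n - 1) j (face C n j Minus D))"
      using pcomp_interchange[of n i A D B F j] AB' DF' AD BF ij by simp
    also have "\<dots> = degen C (n - 1) j (pcomp C (n - 1) (lower i j) (face C n j Minus A) (face C n j Minus D))"
      using degen_pcomp[of "n - 1" "lower i j" "face C n j Minus A" "face C n j Minus D" j]
        composable_face[of n i A D j Minus] AD ij l by simp
    finally show "pcomp C n j (pcomp C n i A D) (pcomp C n i B F) =
      degen C (n - 1) j (face C n j Minus (pcomp C n i A D))"
      using AD ij by (simp add: face_pcomp_neq)
  qed
  have **: "is_R_inverse C n j B A" "is_R_inverse C n j F D"
    using AB DF is_R_inverse_sym by metis+
  show "is_R_inverse C n j (pcomp C n i A D) (pcomp C n i B F)"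
    using *[OF AB DF AD BF] *[OF ** BF AD] unfolding is_R_inverse_def
    by (simp add: composable_def)
qed

lemma R_inverse_degen_same:
  assumes "X \<in> cells C n" "1 \<le> i" "i \<le> n + 1"
  shows "is_R_inverse C (n + 1) i (degen C n i X) (degen C n i X)"
  using assms degen_closed[of X n i] face_degen_eq[of X n i] pcomp_unit_left[of "degen C n i X" "n + 1" i]
  by (simp add: is_R_inverse_def composable_def)

text \<open>With \<open>i\<close> vertical and \<open>i + 1\<close> horizontal, \<open>fold\<close>
  becomes \<open>psi C n i\<close>, \<open>vinv\<close> and \<open>hinv\<close> become inversion in
  directions \<open>i\<close> and \<open>i + 1\<close>, and \<open>einv\<close> becomes inversion of
  \<open>(n - 1)\<close>-cells in direction \<open>i\<close>.\<close>

lemma conn_square: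
  assumes i: "1 \<le> i" "i < n"
  shows "conn_square (cells C n) (cells C (n - 1)) (cells C (n - 2))
    (face C n i Minus) (face C n i Plus) (face C n (i + 1) Minus) (face C n (i + 1) Plus)
    (face C (n - 1) i Minus) (face C (n - 1) i Plus) (degen C (n - 2) i)
    (degen C (n - 1) i) (degen C (n - 1) (i + 1)) (conn C (n - 1) i Plus) (conn C (n - 1) i Minus)
    (pcomp C (n - 1) i) (pcomp C n (i + 1)) (pcomp C n i)"
proof -
  obtain m where n: "n = Suc (Suc m)"
    using i by (cases n; cases "n - 1") auto
  have i': "1 \<le> i" "i \<le> Suc m" using i n by auto
  \<comment> \<open>In dimension \<open>Suc (Suc m)\<close> all subtractions compute, so the
    rewriting of 1 to \<open>Suc 0\<close> is restored for this proof.\<close>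
  note [simp] = One_nat_def
  note closed = face_closed[of _ "Suc (Suc m)", simplified] face_closed[of _ "Suc m", simplified]
       degen_closed[of _ "Suc m", simplified] degen_closed[of _ "m", simplified] conn_closed[of _ "Suc m", simplified]
  note rules = closed face_face_neq[of _ "Suc (Suc m)" i "Suc i", unfolded lower_def, simplified]
    face_degen_eq[of _ "Suc m", simplified] face_degen_eq[of _ m, simplified]
    face_degen_neq[of _ "Suc m" i "Suc i", unfolded lower_def, simplified]
    face_degen_neq[of _ "Suc m" "Suc i" i, unfolded lower_def, simplified]
    face_conn_same[of _ "Suc m" i, simplified]
    face_conn_opposite[of _ "Suc m" i _ Plus, simplified] face_conn_opposite[of _ "Suc m" i _ Minus, simplified]
    pcomp_closed[of "Suc (Suc m)", unfolded composable_def, simplified]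
    pcomp_closed[of "Suc m", unfolded composable_def, simplified]
    face_pcomp_Minus[of "Suc (Suc m)", unfolded composable_def, simplified]
    face_pcomp_Minus[of "Suc m", unfolded composable_def, simplified]
    face_pcomp_Plus[of "Suc (Suc m)", unfolded composable_def, simplified]
    face_pcomp_Plus[of "Suc m", unfolded composable_def, simplified]
    face_pcomp_neq[of "Suc (Suc m)" i _ _ "Suc i", unfolded composable_def lower_def, simplified]
    face_pcomp_neq[of "Suc (Suc m)" "Suc i" _ _ i, unfolded composable_def lower_def, simplified]
    pcomp_unit_left[of _ "Suc (Suc m)", simplified] pcomp_unit_left[of _ "Suc m", simplified]
    pcomp_unit_right[of _ "Suc (Suc m)", simplified] pcomp_unit_right[of _ "Suc m", simplified]
    degen_pcomp[of "Suc m" i _ _ i, unfolded composable_def raise_def, simplified]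
    degen_degen[of _ m i i, simplified] conn_degen_eq[of _ m, simplified]
    conn_transport[of _ "Suc m", simplified] conn_transport_Suc[of _ "Suc m", simplified]
    conn_pcomp_Minus[of "Suc m" i, unfolded composable_def, simplified]
    conn_pcomp_Plus[of "Suc m" i, unfolded composable_def, simplified]
    pcomp_assoc[of "Suc (Suc m)", unfolded composable_def, simplified]
    pcomp_assoc[of "Suc m", unfolded composable_def, simplified]
    pcomp_interchange[of "Suc (Suc m)" _ _ _ _ _ "Suc i", unfolded composable_def]
  show ?thesis unfolding n
    by unfold_locales (use i' in \<open>simp_all add: rules\<close>)
qed

section \<open>Folding a cell\<close>

lemma psi_eq_fold:
  assumes "1 \<le> i" "i < n"
  shows "conn_square.fold (face C n (i + 1) Minus) (face C n (i + 1) Plus) (conn C (n - 1) i Plus)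
    (conn C (n - 1) i Minus) (pcomp C n (i + 1)) = psi C n i"
  by (rule ext) (simp add: conn_square.fold_def[OF conn_square[OF assms]] psi_def)

lemma vinv_iff_R_inverse:
  assumes "1 \<le> i" "i < n"
  shows "conn_square.vinv (cells C n) (face C n i Minus) (face C n i Plus) (degen C (n - 1) i)
      (pcomp C n i) A B \<longleftrightarrow> is_R_inverse C n i A B"
  by (auto simp: conn_square.vinv_def[OF conn_square[OF assms]] is_R_inverse_def composable_def)

lemma hinv_iff_R_inverse:
  assumes "1 \<le> i" "i < n"
  shows "conn_square.hinv (cells C n) (face C n (i + 1) Minus) (face C n (i + 1) Plus)
      (degen C (n - 1) (i + 1)) (pcomp C n (i + 1)) A B \<longleftrightarrow> is_R_inverse C n (i + 1) A B"
  by (auto simp: conn_square.hinv_def[OF conn_square[OF assms]] is_R_inverse_def composable_def)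

lemma einv_iff_R_inverse:
  assumes "1 \<le> i" "i < n"
  shows "conn_square.einv (cells C (n - 1)) (face C (n - 1) i Minus) (face C (n - 1) i Plus)
      (degen C (n - 2) i) (pcomp C (n - 1) i) x y \<longleftrightarrow> is_R_inverse C (n - 1) i x y"
  by (auto simp: conn_square.einv_def[OF conn_square[OF assms]] is_R_inverse_def composable_def)

lemmas square_simps = psi_eq_fold vinv_iff_R_inverse hinv_iff_R_inverse einv_iff_R_inverse

lemma psi_closed: "A \<in> cells C n \<Longrightarrow> 1 \<le> i \<Longrightarrow> i < n \<Longrightarrow> psi C n i A \<in> cells C n"
  using conn_square.fold_in[OF conn_square] square_simps by simp

lemma face_psi:
  assumes "1 \<le> i" "i < n" "A \<in> cells C n"
  shows "face C n i Minus (psi C n i A)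
      = pcomp C (n - 1) i (face C n i Minus A) (face C n (i + 1) Plus A)"
    "face C n i Plus (psi C n i A)
      = pcomp C (n - 1) i (face C n (i + 1) Minus A) (face C n i Plus A)"
    "face C n (i + 1) Minus (psi C n i A)
      = degen C (n - 2) i (face C (n - 1) i Minus (face C n i Minus A))"
    "face C n (i + 1) Plus (psi C n i A)
      = degen C (n - 2) i (face C (n - 1) i Plus (face C n i Plus A))"
  using conn_square.fold_faces[OF conn_square, OF assms] assms by (simp_all add: square_simps)

lemma psi_degen: "1 \<le> i \<Longrightarrow> i < n \<Longrightarrow> X \<in> cells C (n - 1) \<Longrightarrow>
    psi C n i (degen C (n - 1) (i + 1) X) = degen C (n - 1) i X"
  using conn_square.fold_idh[OF conn_square] by (simp add: square_simps)

text \<open>The inverses have one shape: \<open>X\<close> and \<open>Y\<close> are the faces of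
  \<open>A\<close> in direction \<open>i + 1\<close> if \<open>j = i\<close>, and those in direction
  \<open>i\<close> if \<open>j = i + 1\<close>. Foldings of index below \<open>i\<close> respect
  composition in direction \<open>i + 1\<close>, so they can be applied to this shape.\<close>

lemma R_inverse_psi_whiskered:
  assumes "1 \<le> i" "i < n" "is_R_inverse C n j A B" "j = i \<or> j = i + 1"
  shows "\<exists>X\<in>cells C (n - 1). \<exists>Y\<in>cells C (n - 1).
    composable C n (i + 1) (degen C (n - 1) i X) (psi C n i B) \<and>
    composable C n (i + 1) (pcomp C n (i + 1) (degen C (n - 1) i X) (psi C n i B)) (degen C (n - 1) i Y) \<and>
    is_R_inverse C n i (psi C n i A)
      (pcomp C n (i + 1) (pcomp C n (i + 1) (degen C (n - 1) i X) (psi C n i B)) (degen C (n - 1) i Y))"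
proof -
  note S = conn_square[OF assms(1,2)]
  have *: "A \<in> cells C n" "psi C n i B \<in> cells C n"
    using assms psi_closed by (simp_all add: is_R_inverse_def composable_def)
  note closed = conn_square.in_E[OF S *(1)] conn_square.in_Q[OF S] conn_square.hc_in[OF S] *
  show ?thesis
  proof (cases "j = i")
    case True
    note R = assms(3)[unfolded True, folded vinv_iff_R_inverse[OF assms(1,2)]]
    show ?thesis
      using conn_square.vinv_fold_composable[OF S R] conn_square.vinv_fold[OF S R]
      unfolding square_simps[OF assms(1,2)] composable_def
      by (intro bexI[of _ "face C n (i + 1) Minus A"] bexI[of _ "face C n (i + 1) Plus A"])
        (simp_all add: closed)
  next
    case False
    then have j: "j = i + 1" using assms(4) by simp
    note R = assms(3)[unfolded j, folded hinv_iff_R_inverse[OF assms(1,2)]]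
    show ?thesis
      using conn_square.hinv_fold_composable[OF S R] conn_square.hinv_fold[OF S R]
      unfolding square_simps[OF assms(1,2)] composable_def
      by (intro bexI[of _ "face C n i Minus A"] bexI[of _ "face C n i Plus A"])
        (simp_all add: closed)
  qed
qed

lemma conn_edges:
  assumes "1 \<le> i" "i < n" "A \<in> cells C n"
  shows "conn C (n - 1) i Plus (face C n (i + 1) Minus A) \<in> cells C n"
    "conn C (n - 1) i Minus (face C n (i + 1) Plus A) \<in> cells C n"
    "composable C n (i + 1) (conn C (n - 1) i Plus (face C n (i + 1) Minus A)) A"
    "composable C n (i + 1) (pcomp C n (i + 1) (conn C (n - 1) i Plus (face C n (i + 1) Minus A)) A)
       (conn C (n - 1) i Minus (face C n (i + 1) Plus A))"
  using assms face_closed[of A n "i + 1"] conn_closed[of _ "n - 1" i] face_conn_same[of _ "n - 1" i "i + 1"]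
    pcomp_closed[of n "i + 1"] face_pcomp_Plus[of n "i + 1"]
  by (simp_all add: composable_def)

lemma face_psi_neq:
  assumes "1 \<le> i" "i < n" "A \<in> cells C n" "1 \<le> k" "k \<le> n" "k \<noteq> i" "k \<noteq> i + 1"
  shows "face C n k \<alpha> (psi C n i A) = psi C (n - 1) (lower i k) (face C n k \<alpha> A)"
proof -
  have l: "lower i k + 1 = lower (i + 1) k" "lower k (i + 1) = lower k i"
    using assms by (auto simp: lower_def)
  have "face C n k \<alpha> (conn C (n - 1) i \<beta> (face C n (i + 1) \<gamma> A)) =
    conn C (n - 1 - 1) (lower i k) \<beta> (face C (n - 1) (lower i k + 1) \<gamma> (face C n k \<alpha> A))" for \<beta> \<gamma>
    using face_conn_neq[of "face C n (i + 1) \<gamma> A" "n - 1" k i] face_closed[of A n "i + 1" \<gamma>] assms l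
      face_face_neq[of A n "i + 1" k] by simp
  then show ?thesis
    using conn_edges[OF assms(1-3)] assms unfolding psi_def
    by (simp add: face_pcomp_neq l)
qed

text \<open>The connections in \<open>psi C n i A\<close> are taken on faces in direction
  \<open>i + 1\<close>, so every factor is invertible in direction \<open>j < i\<close>, with
  inverse the corresponding factor of \<open>psi C n i B\<close>; composition in direction
  \<open>i + 1\<close> preserves this.\<close>

lemma R_inverse_psi_less:
  assumes "1 \<le> i" "i < n" "is_R_inverse C n j A B" "1 \<le> j" "j < i"
  shows "is_R_inverse C n j (psi C n i A) (psi C n i B)"
proof -
  have "A \<in> cells C n" using assms by (simp add: is_R_inverse_def composable_def)
  note c = conn_edges[OF assms(1,2) this]
  have g: "is_R_inverse C n j (conn C (n - 1) i \<beta> (face C n (i + 1) \<gamma> A))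
    (conn C (n - 1) i \<beta> (face C n (i + 1) \<gamma> B))" for \<beta> \<gamma>
    using R_inverse_conn[of "n - 1" j "face C n (i + 1) \<gamma> A" "face C n (i + 1) \<gamma> B" i]
      R_inverse_face[OF assms(3), of "i + 1"] assms by (simp add: lower_def raise_def)
  show ?thesis unfolding psi_def
    by (intro R_inverse_pcomp(2) g c assms(3)) (use assms in simp_all)
qed

lemma R_invertible_if_psi_same:
  assumes "1 \<le> i" "i < n" "A \<in> cells C n" "\<And>\<alpha>. R_invertible C (n - 1) i (face C n (i + 1) \<alpha> A)"
    "R_invertible C n i (psi C n i A)"
  shows "R_invertible C n i A"
proof -
  from assms(4)[of Minus] assms(4)[of Plus] assms(5)
  obtain x y U where
    "is_R_inverse C (n - 1) i (face C n (i + 1) Minus A) x"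
    "is_R_inverse C (n - 1) i (face C n (i + 1) Plus A) y"
    "is_R_inverse C n i (psi C n i A) U"
    unfolding R_invertible_def by blast
  then show ?thesis
    using conn_square.vinv_if_vinv_fold[OF conn_square, of i n A x y U] assms(1-3)
    by (simp add: square_simps R_invertible_def)
qed

text \<open>On a face in direction \<open>i\<close>, direction \<open>i + 1\<close> of
  \<open>A\<close> is numbered \<open>i\<close>; hence the index in the assumption on faces.\<close>

lemma R_invertible_if_psi_Suc:
  assumes "1 \<le> i" "i < n" "A \<in> cells C n" "\<And>\<alpha>. R_invertible C (n - 1) i (face C n i \<alpha> A)"
    "R_invertible C n i (psi C n i A)"
  shows "R_invertible C n (i + 1) A"
proof -
  from assms(4)[of Minus] assms(4)[of Plus] assms(5)
  obtain x y U where
    "is_R_inverse C (n - 1) i (face C n i Minus A) x"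
    "is_R_inverse C (n - 1) i (face C n i Plus A) y"
    "is_R_inverse C n i (psi C n i A) U"
    unfolding R_invertible_def by blast
  then show ?thesis
    using conn_square.hinv_if_vinv_fold[OF conn_square, of i n A x y U] assms(1-3)
    by (simp add: square_simps R_invertible_def)
qed

lemma R_invertible_pcomp:
  assumes "R_invertible C n j A" "R_invertible C n j D" "composable C n i A D"
    "1 \<le> j" "j \<le> n" "1 \<le> i" "i \<le> n" "i \<noteq> j"
  shows "R_invertible C n j (pcomp C n i A D)"
  using assms R_inverse_pcomp(2) unfolding R_invertible_def by blast

lemma R_invertible_face:
  assumes "R_invertible C n j A" "1 \<le> j" "j \<le> n" "1 \<le> k" "k \<le> n" "j \<noteq> k"
  shows "R_invertible C (n - 1) (lower j k) (face C n k \<alpha> A)"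
  using assms R_inverse_face unfolding R_invertible_def by blast

lemma R_invertible_degen:
  assumes "R_invertible C n j A" "1 \<le> j" "j \<le> n" "1 \<le> i" "i \<le> n + 1"
  shows "R_invertible C (n + 1) (raise j i) (degen C n i A)"
  using assms R_inverse_degen unfolding R_invertible_def by blast

lemma R_invertible_conn:
  assumes "R_invertible C n j A" "1 \<le> j" "j \<le> n" "1 \<le> i" "i \<le> n" "i \<noteq> j"
  shows "R_invertible C (n + 1) (raise j i) (conn C n i \<alpha> A)"
  using assms R_inverse_conn unfolding R_invertible_def by blast

text \<open>Direction \<open>j\<close> lies outside the double category, so \<open>A\<close> is
  treated as the unfolding of \<open>psi C n i A\<close>: a composite in directions \<open>i\<close>
  and \<open>i + 1\<close> of that cell with degeneracies and connections of faces, each of them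
  invertible in direction \<open>j\<close>.\<close>

lemma R_invertible_if_psi_less:
  assumes "1 \<le> i" "i < n" "A \<in> cells C n" "1 \<le> j" "j < i"
    and inv: "\<And>\<alpha>. R_invertible C (n - 1) j (face C n i \<alpha> A)"
      "\<And>\<alpha>. R_invertible C (n - 1) j (face C n (i + 1) \<alpha> A)" "R_invertible C n j (psi C n i A)"
  shows "R_invertible C n j A"
proof -
  note S = conn_square[OF assms(1,2)]
  \<comment> \<open>\<open>?X\<close> and \<open>?Y\<close> are the top and bottom rows of the
    unfolding.\<close>
  let ?X = "pcomp C n (i + 1) (degen C (n - 1) i (face C n i Minus A)) (conn C (n - 1) i Plus (face C n (i + 1) Plus A))"
  let ?Y = "pcomp C n (i + 1) (conn C (n - 1) i Minus (face C n (i + 1) Minus A)) (degen C (n - 1) i (face C n i Plus A))"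
  have eq: "A = pcomp C n i (pcomp C n i ?X (psi C n i A)) ?Y"
    using conn_square.unfold_fold[OF S assms(3)]
    unfolding psi_eq_fold[OF assms(1,2)] conn_square.unfold_def[OF S] by (rule sym)
  have "R_invertible C n j (degen C (n - 1) i (face C n i \<alpha> A))" for \<alpha>
    using R_invertible_degen[OF inv(1), of i \<alpha>] assms(1-5) by (simp add: raise_def)
  moreover have "R_invertible C n j (conn C (n - 1) i \<beta> (face C n (i + 1) \<alpha> A))" for \<alpha> \<beta>
    using R_invertible_conn[OF inv(2), of i \<beta> \<alpha>] assms(1-5) by (simp add: raise_def)
  moreover have "composable C n (i + 1) (degen C (n - 1) i (face C n i Minus A)) (conn C (n - 1) i Plus (face C n (i + 1) Plus A))"
     "composable C n (i + 1) (conn C (n - 1) i Minus (face C n (i + 1) Minus A)) (degen C (n - 1) i (face C n i Plus A))"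
     "composable C n i ?X (psi C n i A)"
     "composable C n i (pcomp C n i ?X (psi C n i A)) ?Y"
    using conn_square.unfold_fold_composable[OF S assms(3)] assms(1-5)
      conn_square.in_Q[OF S] conn_square.in_E[OF S assms(3)] psi_closed
    unfolding composable_def by (simp_all add: square_simps)
  ultimately have "R_invertible C n j (pcomp C n i (pcomp C n i ?X (psi C n i A)) ?Y)"
    using assms by (intro R_invertible_pcomp) simp_all
  then show ?thesis by (simp only: eq[symmetric])
qed

text \<open>Beyond direction \<open>i + 1\<close>, the faces and connections in \<open>psi\<close>
  preserve the composition, and \<open>pcomp_interchange\<close> moves it past the composition in
  direction \<open>i + 1\<close>.\<close>

lemma psi_pcomp:
  assumes AB: "composable C n j A B" and i: "1 \<le> i" "i + 1 < j" "j \<le> n"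
  shows "composable C n j (psi C n i A) (psi C n i B)"
    "psi C n i (pcomp C n j A B) = pcomp C n j (psi C n i A) (psi C n i B)"
proof -
  have cells: "A \<in> cells C n" "B \<in> cells C n" "face C n j Plus A = face C n j Minus B" "i < n"
    using AB i by (simp_all add: composable_def)
  note A = conn_edges[OF i(1) cells(4) cells(1)] and B = conn_edges[OF i(1) cells(4) cells(2)]
  show "composable C n j (psi C n i A) (psi C n i B)"
    using cells i by (simp add: composable_def psi_closed face_psi_neq)
  let ?G = "\<lambda>\<beta> \<gamma> A. conn C (n - 1) i \<beta> (face C n (i + 1) \<gamma> A)"
  have l: "lower j (i + 1) = j - 1" "raise (j - 1) i = j"
    using i by (auto simp: lower_def raise_def)
  have fAB: "composable C (n - 1) (j - 1) (face C n (i + 1) \<gamma> A) (face C n (i + 1) \<gamma> B)" for \<gamma>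
    using composable_face[OF AB, of "i + 1" \<gamma>] i l by simp
  have G: "composable C n j (?G \<beta> \<gamma> A) (?G \<beta> \<gamma> B)"
    "?G \<beta> \<gamma> (pcomp C n j A B) = pcomp C n j (?G \<beta> \<gamma> A) (?G \<beta> \<gamma> B)" for \<beta> \<gamma>
    using composable_conn[OF fAB, of i \<beta> \<gamma>] conn_pcomp_neq[OF fAB, of i \<beta> \<gamma>]
      face_pcomp_neq[OF AB, of "i + 1" \<gamma>] i l by simp_all
  have "pcomp C n (i + 1) (pcomp C n j (?G Plus Minus A) (?G Plus Minus B)) (pcomp C n j A B)
    = pcomp C n j (pcomp C n (i + 1) (?G Plus Minus A) A) (pcomp C n (i + 1) (?G Plus Minus B) B)"
    using pcomp_interchange[OF G(1) AB A(3) B(3)] i by simp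
  moreover have "composable C n j (pcomp C n (i + 1) (?G Plus Minus A) A) (pcomp C n (i + 1) (?G Plus Minus B) B)"
    using A(3) B(3) G(1)[of Plus Minus] AB i
    by (simp add: composable_def[of _ _ j] face_pcomp_neq pcomp_closed)
  ultimately show "psi C n i (pcomp C n j A B) = pcomp C n j (psi C n i A) (psi C n i B)"
    using pcomp_interchange[OF _ G(1) A(4) B(4)] i by (simp add: psi_def G(2))
qed

section \<open>Iterated folding\<close>

definition psi_upto :: "nat \<Rightarrow> nat \<Rightarrow> 'a \<Rightarrow> 'a" where
  "psi_upto n k A = foldr (psi C n) [1..<Suc k] A"

text \<open>The operator of largest index acts first, so recursion peels it off on the inside, and
  inductions on \<open>k\<close> generalise over the cell.\<close>

lemma psi_upto_simps [simp]:
  "psi_upto n 0 A = A" "psi_upto n (Suc k) A = psi_upto n k (psi C n (Suc k) A)"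
  by (simp_all add: psi_upto_def)

lemma Psi_eq_psi_upto: "1 \<le> n \<Longrightarrow> Psi C n A = psi_upto n (n - 1) A"
  by (simp add: Psi_def psi_upto_def)

lemma psi_upto_pcomp:
  "composable C n j A B \<Longrightarrow> k + 1 < j \<Longrightarrow> j \<le> n \<Longrightarrow>
    composable C n j (psi_upto n k A) (psi_upto n k B) \<and>
    psi_upto n k (pcomp C n j A B) = pcomp C n j (psi_upto n k A) (psi_upto n k B)"
  by (induction k arbitrary: A B) (simp_all add: psi_pcomp)

text \<open>By \<open>psi_degen\<close> each folding lowers the degenerate direction by one, from
  \<open>Suc k\<close> down to 1.\<close>

lemma psi_upto_degen:
  "X \<in> cells C (n - 1) \<Longrightarrow> k < n \<Longrightarrow> psi_upto n k (degen C (n - 1) (Suc k) X) = degen C (n - 1) 1 X"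
proof (induction k)
  case (Suc k)
  then show ?case using psi_degen[of "Suc k" n X] by (simp add: One_nat_def)
qed (simp add: One_nat_def)

lemma degen_image_pcomp:
  assumes "A \<in> degen C (n - 1) 1 ` cells C (n - 1)" "B \<in> degen C (n - 1) 1 ` cells C (n - 1)"
    "composable C n j A B" "1 < j" "j \<le> n"
  shows "pcomp C n j A B \<in> degen C (n - 1) 1 ` cells C (n - 1)"
proof -
  obtain X Y where XY: "X \<in> cells C (n - 1)" "A = degen C (n - 1) 1 X" "Y \<in> cells C (n - 1)"
    "B = degen C (n - 1) 1 Y" using assms by blast
  have r: "raise (j - 1) 1 = j" "lower 1 j = 1" "1 \<le> j - 1" "j - 1 \<le> n - 1"
    using assms by (auto simp: raise_def lower_def)
  have n: "n - 2 + 1 = n - 1" using assms(4,5) by simp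
  \<comment> \<open>The aim is composability of \<open>X\<close> and \<open>Y\<close>: the matching
    faces of \<open>A\<close> and \<open>B\<close> are degenerate, and \<open>degen\<close> is
    injective by \<open>face_degen_eq\<close>.\<close>
  have "degen C (n - 2) 1 (face C (n - 1) (j - 1) Plus X) = degen C (n - 2) 1 (face C (n - 1) (j - 1) Minus Y)"
    using face_degen_raise[of X "n - 1" 1 "j - 1" Plus] face_degen_raise[of Y "n - 1" 1 "j - 1" Minus]
       XY assms(3-) r by (simp add: composable_def)
  moreover have "face C (n - 1) (j - 1) Plus X \<in> cells C (n - 2)" "face C (n - 1) (j - 1) Minus Y \<in> cells C (n - 2)"
    using face_closed[of X "n - 1" "j - 1"] face_closed[of Y "n - 1" "j - 1"] XY assms(4,5) by simp_all
  ultimately have "face C (n - 1) (j - 1) Plus X = face C (n - 1) (j - 1) Minus Y"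
    using face_degen_eq[of _ "n - 2" 1 Minus] by (metis le_add2 order_refl)
  then have c: "composable C (n - 1) (j - 1) X Y" using XY by (simp add: composable_def)
  then have "pcomp C n j A B = degen C (n - 1) 1 (pcomp C (n - 1) (j - 1) X Y)"
    using degen_pcomp[OF c, of 1] XY assms(4,5) r by simp
  then show ?thesis
    using pcomp_closed[OF c r(3,4)] by (rule image_eqI)
qed

text \<open>\<open>min j i\<close> tracks the direction: one below \<open>i\<close> is kept, while
  \<open>i\<close> and \<open>i + 1\<close> both become \<open>i\<close>.\<close>

lemma R_invertible_psi:
  assumes "1 \<le> i" "i < n" "1 \<le> j" "j \<le> i + 1" "R_invertible C n j A"
  shows "R_invertible C n (min j i) (psi C n i A)"
proof (cases "j < i")
  case True
  then show ?thesis
    using assms R_inverse_psi_less unfolding R_invertible_def by (metis less_imp_le min.absorb1)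
next
  case False
  then have j: "j = i \<or> j = i + 1" "min j i = i" using assms by auto
  then show ?thesis
    using assms R_inverse_psi_whiskered[of i n j] unfolding R_invertible_def by metis
qed

lemma R_invertible_psi_upto:
  "k < n \<Longrightarrow> 1 \<le> j \<Longrightarrow> j \<le> k + 1 \<Longrightarrow> R_invertible C n j A \<Longrightarrow> R_invertible C n 1 (psi_upto n k A)"
proof (induction k arbitrary: j A)
  case (Suc k)
  show ?case
    using Suc.IH[of "min j (Suc k)" "psi C n (Suc k) A"] R_invertible_psi[of "Suc k" n j A] Suc.prems
    by simp
qed (simp add: One_nat_def)

text \<open>
  When the direction is \<open>Suc k\<close> or \<open>Suc k + 1\<close>, the induction continues not with the folded \<open>A\<close> but with
  the inverse of the folded \<open>B\<close>, which is the folded \<open>A\<close> composed with degenerate cells.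
\<close>

lemma thin_R_inverse:
  "k < n \<Longrightarrow> 1 \<le> j \<Longrightarrow> j \<le> k + 1 \<Longrightarrow> is_R_inverse C n j A B \<Longrightarrow>
    psi_upto n k A \<in> degen C (n - 1) 1 ` cells C (n - 1) \<Longrightarrow>
    psi_upto n k B \<in> degen C (n - 1) 1 ` cells C (n - 1)"
proof (induction k arbitrary: j A B)
  case 0
  then obtain X where X: "X \<in> cells C (n - 1)" "A = degen C (n - 1) 1 X" and "j = 1" by auto
  \<comment> \<open>A cell degenerate in direction 1 is its own inverse there.\<close>
  then have "B = A"
    using R_inverse_degen_same[of X "n - 1" 1] R_inverse_unique[of n 1 A] 0 by simp
  then show ?case using 0 by simp
next
  case (Suc k)
  let ?i = "Suc k"
  show ?case
  proof (cases "j < ?i")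
    case True
    then show ?thesis
      using Suc.IH[of j "psi C n ?i A" "psi C n ?i B"] R_inverse_psi_less[of ?i n j A B] Suc.prems
      by simp
  next
    case False
    have "is_R_inverse C n j B A"
      using Suc.prems is_R_inverse_sym by metis
    then obtain X Y where XY: "X \<in> cells C (n - 1)" "Y \<in> cells C (n - 1)"
      "composable C n (?i + 1) (degen C (n - 1) ?i X) (psi C n ?i A)"
      "composable C n (?i + 1) (pcomp C n (?i + 1) (degen C (n - 1) ?i X) (psi C n ?i A)) (degen C (n - 1) ?i Y)"
      and inv: "is_R_inverse C n ?i (psi C n ?i B)
        (pcomp C n (?i + 1) (pcomp C n (?i + 1) (degen C (n - 1) ?i X) (psi C n ?i A)) (degen C (n - 1) ?i Y))"
        (is "is_R_inverse C n ?i _ ?W")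
      using R_inverse_psi_whiskered[of ?i n j B A] Suc.prems False by force
    \<comment> \<open>\<open>?W\<close> is composed in direction \<open>?i + 1\<close>, which
      exceeds \<open>k + 1\<close>, so \<open>psi_upto n k\<close> passes to its factors and turns
      the two outer ones into degenerate cells in direction 1.\<close>
    have "psi_upto n k ?W \<in> degen C (n - 1) 1 ` cells C (n - 1)"
      using psi_upto_pcomp[OF XY(3), of k] psi_upto_pcomp[OF XY(4), of k] XY(1,2) Suc.prems
        psi_upto_degen[of X n k] psi_upto_degen[of Y n k]
      by (auto intro!: degen_image_pcomp)
    moreover have "is_R_inverse C n ?i ?W (psi C n ?i B)"
      using inv is_R_inverse_sym by metis
    ultimately show ?thesis
      using Suc.IH[of ?i ?W "psi C n ?i B"] Suc.prems by simp
  qed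
qed

section \<open>Undoing the foldings by means of invertible faces\<close>

definition R_invertible_faces :: "nat \<Rightarrow> nat \<Rightarrow> 'a \<Rightarrow> bool" where
  "R_invertible_faces n j A \<longleftrightarrow> (\<forall>k \<alpha>. 1 \<le> k \<longrightarrow> k \<le> n \<longrightarrow> k \<noteq> j \<longrightarrow>
     R_invertible C (n - 1) (lower j k) (face C n k \<alpha> A))"

text \<open>The position of \<open>j\<close> decides which faces the unfolding calls for: those in
  both directions \<open>i\<close> and \<open>i + 1\<close> if \<open>j < i\<close>, in direction
  \<open>i + 1\<close> if \<open>j = i\<close>, in direction \<open>i\<close> if
  \<open>j = i + 1\<close>.\<close>

lemma R_invertible_if_psi:
  assumes "1 \<le> i" "i < n" "A \<in> cells C n" "1 \<le> j" "j \<le> i + 1" "R_invertible_faces n j A"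
    "R_invertible C n (min j i) (psi C n i A)"
  shows "R_invertible C n j A"
proof -
  have f: "R_invertible C (n - 1) (lower j k) (face C n k \<alpha> A)" if "1 \<le> k" "k \<le> n" "k \<noteq> j" for k \<alpha>
    using assms(6) that by (simp add: R_invertible_faces_def)
  consider "j < i" | "j = i" | "j = i + 1" using assms by linarith
  then show ?thesis
  proof cases
    case 1
    then show ?thesis
      using assms f[of i] f[of "i + 1"] by - (rule R_invertible_if_psi_less[of i]; simp add: lower_def)
  next
    case 2
    then show ?thesis
      using assms f[of "i + 1"] R_invertible_if_psi_same[of i n A] by (simp_all add: lower_def)
  next
    case 3
    then show ?thesis
      using assms f[of i] R_invertible_if_psi_Suc[of i n A] by (simp_all add: lower_def)
  qed
qed

text \<open>Keeps the hypothesis on faces alive through the induction. Depending on its direction, a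
  face of \<open>psi C n i A\<close> is a folded face of \<open>A\<close>, a composite of two faces,
  or degenerate.\<close>

lemma R_invertible_faces_psi:
  assumes i: "1 \<le> i" "i < n" and A: "A \<in> cells C n" and j: "1 \<le> j" "j \<le> i + 1"
    and inv: "R_invertible_faces n j A"
  shows "R_invertible_faces n (min j i) (psi C n i A)"
  unfolding R_invertible_faces_def
proof (intro allI impI)
  fix k \<alpha>
  assume k: "1 \<le> k" "k \<le> n" "k \<noteq> min j i"
  have f: "R_invertible C (n - 1) (lower j k) (face C n k \<alpha> A)" if "1 \<le> k" "k \<le> n" "k \<noteq> j" for k \<alpha>
    using inv that by (simp add: R_invertible_faces_def)
  consider "k \<noteq> i" "k \<noteq> i + 1" | "k = i" | "k = i + 1" by linarith
  then show "R_invertible C (n - 1) (lower (min j i) k) (face C n k \<alpha> (psi C n i A))"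
  proof cases
    case 1
    have l: "1 \<le> lower i k" "lower i k < n - 1" "1 \<le> lower j k" "lower j k \<le> lower i k + 1"
      "min (lower j k) (lower i k) = lower (min j i) k" "k \<noteq> j"
      using 1 i j k by (auto simp: lower_def)
    show ?thesis
      using R_invertible_psi[OF l(1-4) f] l face_psi_neq[OF i A k(1,2) 1] k by simp
  next
    case 2
    then have ji: "j < i" using k by simp
    have inv: "R_invertible C (n - 1) j (face C n i \<alpha> A)" "R_invertible C (n - 1) j (face C n (i + 1) \<alpha> A)" for \<alpha>
      using f[of i \<alpha>] f[of "i + 1" \<alpha>] ji i by (simp_all add: lower_def)
    have "composable C (n - 1) i (face C n i Minus A) (face C n (i + 1) Plus A)"
      "composable C (n - 1) i (face C n (i + 1) Minus A) (face C n i Plus A)"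
      using i A face_face[OF A i(1), of "i + 1" Plus Minus] face_face[OF A i(1), of "i + 1" Minus Plus]
      by (simp_all add: composable_def face_closed)
    then have "R_invertible C (n - 1) j (pcomp C (n - 1) i (face C n i Minus A) (face C n (i + 1) Plus A))"
      "R_invertible C (n - 1) j (pcomp C (n - 1) i (face C n (i + 1) Minus A) (face C n i Plus A))"
      using R_invertible_pcomp[OF inv(1)[of Minus] inv(2)[of Plus], of i]
        R_invertible_pcomp[OF inv(2)[of Minus] inv(1)[of Plus], of i] ji i j(1) by simp_all
    then show ?thesis
      using face_psi(1,2)[OF i A] ji 2 by (cases \<alpha>) (simp_all add: lower_def)
  next
    case 3
    have n: "n - 2 + 1 = n - 1" using i by simp
    have face: "face C n k \<alpha> (psi C n i A) = degen C (n - 2) i (face C (n - 1) i \<alpha> (face C n i \<alpha> A))"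
      using face_psi(3,4)[OF i A] 3 by (cases \<alpha>) simp_all
    \<comment> \<open>If \<open>j < i\<close>, the degenerate face inherits invertibility from an
      iterated face of \<open>A\<close>. Otherwise the direction in question is \<open>i\<close>, in
      which the degenerate face is its own inverse.\<close>
    show ?thesis
    proof (cases "j < i")
      case True
      have "R_invertible C (n - 1) j (face C n i \<alpha> A)"
        using f[of i \<alpha>] True i by (simp add: lower_def)
      then have "R_invertible C (n - 2) j (face C (n - 1) i \<alpha> (face C n i \<alpha> A))"
        using R_invertible_face[of "n - 1" j "face C n i \<alpha> A" i \<alpha>] True i j by (simp add: lower_def)
      then show ?thesis
        unfolding face using R_invertible_degen[of "n - 2" j _ i, unfolded n] True i j 3
        by (simp add: lower_def raise_def)
    next
      case False
      have "face C (n - 1) i \<alpha> (face C n i \<alpha> A) \<in> cells C (n - 2)"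
        using face_closed[of "face C n i \<alpha> A" "n - 1" i \<alpha>] face_closed[of A n i \<alpha>] A i
        by simp
      from R_inverse_degen_same[OF this, of i, unfolded n] have
        "is_R_inverse C (n - 1) i (degen C (n - 2) i (face C (n - 1) i \<alpha> (face C n i \<alpha> A)))
          (degen C (n - 2) i (face C (n - 1) i \<alpha> (face C n i \<alpha> A)))"
        using i by simp
      moreover have "lower (min j i) k = i"
        using False 3 by (simp add: lower_def)
      ultimately show ?thesis
        unfolding face R_invertible_def by auto
    qed
  qed
qed

text \<open>The induction hypothesis for \<open>psi C n (Suc k) A\<close>, whose faces are again
  invertible, undoes the later foldings; \<open>R_invertible_if_psi\<close> undoes the
  first.\<close>

lemma R_invertible_if_psi_upto:
  "k < n \<Longrightarrow> A \<in> cells C n \<Longrightarrow> 1 \<le> j \<Longrightarrow> j \<le> k + 1 \<Longrightarrow> R_invertible_faces n j A \<Longrightarrow>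
    R_invertible C n 1 (psi_upto n k A) \<Longrightarrow> R_invertible C n j A"
proof (induction k arbitrary: j A)
  case 0
  then have "j = 1" by simp
  with 0 show ?case by simp
next
  case (Suc k)
  have "R_invertible C n (min j (Suc k)) (psi C n (Suc k) A)"
    using Suc.IH[of "psi C n (Suc k) A" "min j (Suc k)"] R_invertible_faces_psi[of "Suc k" n A j]
      Suc.prems psi_closed[of A n "Suc k"] by simp
  then show ?case
    using R_invertible_if_psi[of "Suc k" n A j] Suc.prems by simp
qed

end

section \<open>Shells\<close>

lemma mk_family_eq_iff:
  "mk_family N F = mk_family N G \<longleftrightarrow> (\<forall>i \<alpha>. 1 \<le> i \<longrightarrow> i \<le> N \<longrightarrow> F i \<alpha> = G i \<alpha>)"
  by (auto simp: mk_family_def fun_eq_iff)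

lemma family_mk_family [simp]: "1 \<le> i \<Longrightarrow> i \<le> N \<Longrightarrow> family (mk_family N F) i \<alpha> = F i \<alpha>"
  by (simp add: mk_family_def)

lemma all_sign_iff: "(\<forall>\<alpha>. P \<alpha>) \<longleftrightarrow> P Minus \<and> P Plus"
  by (metis sign.exhaust)

lemma trunc_simps [simp]:
  "m \<le> n \<Longrightarrow> cells (trunc n C) m = cells C m" "face (trunc n C) = face C"
  "degen (trunc n C) = degen C" "pcomp (trunc n C) = pcomp C"
  by (simp_all add: trunc_def)

text \<open>The defining set ranges over representatives; the conditions concern indices from 1 to
  \<open>n + 1\<close> alone, where representatives of one family agree.\<close>

lemma mem_matching_families_iff:
  "mk_family (n + 1) F \<in> matching_families n C \<longleftrightarrow>
    (\<forall>i \<alpha>. 1 \<le> i \<longrightarrow> i \<le> n + 1 \<longrightarrow> F i \<alpha> \<in> cells C n) \<and>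
    (\<forall>i j \<alpha> \<beta>. 1 \<le> i \<longrightarrow> i \<le> n + 1 \<longrightarrow> 1 \<le> j \<longrightarrow> j \<le> n + 1 \<longrightarrow> i \<noteq> j \<longrightarrow>
      face C n (lower i j) \<alpha> (F j \<beta>) = face C n (lower j i) \<beta> (F i \<alpha>))"
  (is "_ \<longleftrightarrow> ?P F")
proof
  assume "mk_family (n + 1) F \<in> matching_families n C"
  then obtain G where G: "mk_family (n + 1) F = mk_family (n + 1) G"
    and 1: "\<forall>i\<in>{1..n + 1}. \<forall>\<alpha>. G i \<alpha> \<in> cells C n"
    and 2: "\<forall>i\<in>{1..n + 1}. \<forall>j\<in>{1..n + 1}. i \<noteq> j \<longrightarrow> (\<forall>\<alpha> \<beta>.
           face C n (lower i j) \<alpha> (G j \<beta>) = face C n (lower j i) \<beta> (G i \<alpha>))"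
    unfolding matching_families_def by blast
  have "?P G" using 1 2 by auto
  then show "?P F" using G by (simp add: mk_family_eq_iff)
next
  assume "?P F"
  then show "mk_family (n + 1) F \<in> matching_families n C"
    unfolding matching_families_def by (auto intro!: exI[of _ F])
qed

text \<open>Families are compared member by member. Direction \<open>j\<close> contributes the
  composability conditions, every other direction \<open>k\<close> two equations whose right sides
  are members of a degenerate shell.\<close>

lemma is_R_inverse_box_iff:
  assumes A: "mk_family n F \<in> matching_families (n - 1) (trunc (n - 1) C)"
    and B: "mk_family n G \<in> matching_families (n - 1) (trunc (n - 1) C)"
    and j: "1 \<le> j" "j \<le> n"
  shows "is_R_inverse (box (n - 1) (trunc (n - 1) C)) n j (mk_family n F) (mk_family n G) \<longleftrightarrow>
    F j Plus = G j Minus \<and> G j Plus = F j Minus \<and>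
    (\<forall>k \<alpha>. 1 \<le> k \<longrightarrow> k \<le> n \<longrightarrow> k \<noteq> j \<longrightarrow>
      pcomp C (n - 1) (lower j k) (F k \<alpha>) (G k \<alpha>)
        = degen C (n - 2) (lower j k) (face C (n - 1) (lower k j) \<alpha> (F j Minus)) \<and>
      pcomp C (n - 1) (lower j k) (G k \<alpha>) (F k \<alpha>)
        = degen C (n - 2) (lower j k) (face C (n - 1) (lower k j) \<alpha> (F j Plus)))"
proof -
  have n: "n - 1 + 1 = n" "\<not> n \<le> n - 1" using j by auto
  show ?thesis
    using A B j n unfolding is_R_inverse_def composable_def box_def
    by (auto simp: mk_family_eq_iff all_sign_iff)
qed

context cubical_omega_category
begin

lemma shell_matching:
  assumes "A \<in> cells C n" "1 \<le> n"
  shows "shell C n A \<in> matching_families (n - 1) (trunc (n - 1) C)"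
  using assms mem_matching_families_iff[of "n - 1" "\<lambda>i \<alpha>. face C n i \<alpha> A" "trunc (n - 1) C"]
  by (simp add: shell_def face_closed face_face_neq)

lemma R_invertible_shell:
  assumes "R_invertible C n j A" "1 \<le> j" "j \<le> n"
  shows "has_R_invertible_shell C n j A"
proof -
  obtain B where B: "is_R_inverse C n j A B" using assms by (auto simp: R_invertible_def)
  have AB: "A \<in> cells C n" "B \<in> cells C n" using B by (simp_all add: is_R_inverse_def composable_def)
  have "is_R_inverse (box (n - 1) (trunc (n - 1) C)) n j (shell C n A) (shell C n B)"
    unfolding shell_def
  proof (subst is_R_inverse_box_iff, goal_cases)
    \<comment> \<open>This is the criterion by members; the other goals are the side conditions of
      the rewriting.\<close>
    case 5
    have "pcomp C (n - 1) (lower j k) (face C n k \<alpha> A) (face C n k \<alpha> B)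
        = degen C (n - 2) (lower j k) (face C (n - 1) (lower k j) \<alpha> (face C n j Minus A)) \<and>
      pcomp C (n - 1) (lower j k) (face C n k \<alpha> B) (face C n k \<alpha> A)
        = degen C (n - 2) (lower j k) (face C (n - 1) (lower k j) \<alpha> (face C n j Plus A))"
      if "1 \<le> k" "k \<le> n" "k \<noteq> j" for k \<alpha>
      using R_inverse_face[OF B, of k \<alpha>] face_face_neq[of A n j k \<alpha>] AB assms that
      by (simp add: is_R_inverse_def)
    then show ?case using B by (simp add: is_R_inverse_def composable_def)
  qed (use shell_matching[of A n] shell_matching[of B n] AB assms in \<open>simp_all add: shell_def\<close>)
  then show ?thesis unfolding has_R_invertible_shell_def R_invertible_def by blast
qed

lemma R_invertible_faces_if_shell:
  assumes A: "A \<in> cells C n" and j: "1 \<le> j" "j \<le> n" and "has_R_invertible_shell C n j A"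
  shows "R_invertible_faces n j A"
proof -
  have n: "n - 1 + 1 = n" "\<not> n \<le> n - 1" using j by auto
  obtain T where T: "is_R_inverse (box (n - 1) (trunc (n - 1) C)) n j (shell C n A) T"
    using assms by (auto simp: has_R_invertible_shell_def R_invertible_def)
  then have "T \<in> matching_families (n - 1) (trunc (n - 1) C)"
    using n by (simp add: is_R_inverse_def composable_def box_def)
  then obtain G where G: "T = mk_family n G"
    by (auto simp: matching_families_def n)
  have matching: "mk_family n G \<in> matching_families (n - 1) (trunc (n - 1) C)"
    using \<open>T \<in> _\<close> G by simp
  note G_faces = mem_matching_families_iff[of "n - 1" G "trunc (n - 1) C", unfolded n, THEN iffD1, OF matching]
  note inv = is_R_inverse_box_iff[OF shell_matching[OF A, unfolded shell_def] matching j, THEN iffD1,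
    OF _ T[unfolded shell_def G]]
  show ?thesis unfolding R_invertible_faces_def
  proof (intro allI impI)
    fix k \<alpha> assume k: "1 \<le> k" "k \<le> n" "k \<noteq> j"
    \<comment> \<open>Matching expresses the faces of \<open>G k \<alpha>\<close> in direction
      \<open>j\<close> by the members \<open>G j\<close>, which are those of the shell of
      \<open>A\<close> with signs exchanged; this yields composability with the face of
      \<open>A\<close>.\<close>
    have G_cells: "G k \<alpha> \<in> cells C (n - 1)"
      and G_match: "\<And>\<beta>. face C (n - 1) (lower j k) \<beta> (G k \<alpha>) = face C (n - 1) (lower k j) \<alpha> (G j \<beta>)"
      using G_faces k j by simp_all
    have "is_R_inverse C (n - 1) (lower j k) (face C n k \<alpha> A) (G k \<alpha>)"
      using inv G_cells G_match face_face_neq[OF A k(1,2) j k(3)] face_closed[OF A] j k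
      by (simp add: is_R_inverse_def composable_def)
    then show "R_invertible C (n - 1) (lower j k) (face C n k \<alpha> A)"
      unfolding R_invertible_def by blast
  qed
qed

end

section \<open>The invertibility criterion and thinness of inverses\<close>

theorem proposition3p2p5:
  fixes C :: "'a cubical" and n j :: nat and A :: 'a
  assumes "cubical_omega_category C"
    and "A \<in> cells C n"
    and "1 \<le> j" and "j \<le> n"
  shows "(R_invertible C n j A \<longleftrightarrow> invertible C n A \<and> has_R_invertible_shell C n j A) \<and>
    (\<forall>B. thin C n A \<and> is_R_inverse C n j A B \<longrightarrow> thin C n B \<and> R_invertible C n j B)"
proof -
  interpret cubical_omega_category C by (fact assms(1))
  \<comment> \<open>With \<open>k = n - 1\<close>, \<open>psi_upto n k\<close> is
    \<open>Psi C n\<close> and the bound \<open>j \<le> k + 1\<close> reads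
    \<open>j \<le> n\<close>.\<close>
  have n: "n - 1 < n" "j \<le> n - 1 + 1" "1 \<le> n" using assms by auto
  have "invertible C n A" if "R_invertible C n j A"
    using R_invertible_psi_upto[OF n(1) assms(3) n(2) that] assms n
    by (simp add: invertible_def Psi_eq_psi_upto)
  moreover have "R_invertible C n j A" if "invertible C n A" "has_R_invertible_shell C n j A"
    using R_invertible_if_psi_upto[OF n(1) assms(2,3) n(2)] R_invertible_faces_if_shell[OF assms(2-)] that n
    by (simp add: invertible_def Psi_eq_psi_upto)
  moreover have "thin C n B \<and> R_invertible C n j B" if "thin C n A" "is_R_inverse C n j A B" for B
    using thin_R_inverse[OF n(1) assms(3) n(2) that(2)] that n is_R_inverse_sym[of C n j A B]
    by (auto simp: thin_def Psi_eq_psi_upto R_invertible_def is_R_inverse_def composable_def)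
  ultimately show ?thesis using R_invertible_shell assms by blast
qed

end
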